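(* Let $C$ be a generic genus three curve $y^2=\sum_{i=0}^{8}\binom{8}{i}a_ix^i$ with covariant Kleinian $\wp$-functions and symmetric $5\times5$ matrix $h$ as in the context. Define the antisymmetric $5\times5$ matrix $$A=\begin{pmatrix}0&-\wp_{333}&\wp_{233}&-\wp_{223}+\wp_{133}&\wp_{222}-2\wp_{123}\\ \wp_{333}&0&-\wp_{133}&\wp_{123}&-\wp_{122}+\wp_{113}\\ -\wp_{233}&\wp_{133}&0&-\wp_{113}&\wp_{112}\\ \wp_{223}-\wp_{133}&-\wp_{123}&\wp_{113}&0&-\wp_{111}\\ -\wp_{222}+2\wp_{123}&\wp_{122}-\wp_{113}&-\wp_{112}&\wp_{111}&0\end{pmatrix}.$$ Then $hA=0$.
   Context: Genus three setting: $a_0,\dots,a_8\in\mathbb{C}$ generic. Holomorphic differentials $du_k=x^{k-1}dx/y$ ($k=1,2,3$), coordinates $u=(u_1,u_2,u_3)$ on the Jacobian. The covariant $\wp$-functions $\wp_{ij}=\wp_{ji}$ are meromorphic functions of $u$ defined by requiring that for points $(x,y),(x_1,y_1),(x_2,y_2),(x_3,y_3)$ on $C$, with the $\wp_{ij}$ evaluated at $u=\int^{(x,y)}d\mathbf{u}+\sum_{k=1}^3\int^{(x_k,y_k)}d\mathbf{u}$, one has for $i=1,2,3$: $yy_i-\mathbf{x}h\mathbf{x}_i^T=0$, where $\mathbf{x}=(1,x,\dots,x^4)$, $\mathbf{x}_i=(1,x_i,\dots,x_i^4)$ and $$h=\begin{pmatrix}a_0&4a_1&6a_2-2\wp_{11}&4a_3-2\wp_{12}&a_4-2\wp_{13}\\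 4a_1&16a_2+4\wp_{11}&24a_3+2\wp_{12}&16a_4-2\wp_{22}+4\wp_{13}&4a_5-2\wp_{23}\\ 6a_2-2\wp_{11}&24a_3+2\wp_{12}&36a_4+4\wp_{22}-4\wp_{13}&24a_5+2\wp_{23}&6a_6-2\wp_{33}\\ 4a_3-2\wp_{12}&16a_4-2\wp_{22}+4\wp_{13}&24a_5+2\wp_{23}&16a_6+4\wp_{33}&4a_7\\ a_4-2\wp_{13}&4a_5-2\wp_{23}&6a_6-2\wp_{33}&4a_7&a_8\end{pmatrix}.$$ $\wp_{ijk}=\partial\wp_{ij}/\partial u_k$. *)

theory Defs
  imports "HOL-Analysis.Analysis"
begin

type_synonym cvec3 = "complex \<times> complex \<times> complex"

definition fC :: "(nat \<Rightarrow> complex) \<Rightarrow> complex \<Rightarrow> complex" where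
  "fC a x = (\<Sum>i\<le>8. of_nat (8 choose i) * a i * x ^ i)"

definition fC' :: "(nat \<Rightarrow> complex) \<Rightarrow> complex \<Rightarrow> complex" where
  "fC' a x = (\<Sum>i\<in>{1..8}. of_nat (8 choose i) * a i * of_nat i * x ^ (i - 1))"

definition add3 :: "cvec3 \<Rightarrow> cvec3 \<Rightarrow> cvec3" where
  "add3 u v = (fst u + fst v, fst (snd u) + fst (snd v), snd (snd u) + snd (snd v))"

definition upd3 :: "nat \<Rightarrow> complex \<Rightarrow> cvec3 \<Rightarrow> cvec3" where
  "upd3 k t u = (if k = 1 then add3 u (t, 0, 0) else if k = 2 then add3 u (0, t, 0)
                 else add3 u (0, 0, t))"

definition pderiv3 :: "(cvec3 \<Rightarrow> complex) \<Rightarrow> nat \<Rightarrow> cvec3 \<Rightarrow> complex" where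
  "pderiv3 F k u = deriv (\<lambda>t. F (upd3 k t u)) 0"

text \<open>Holomorphy on an open set of C^3: continuous and holomorphic in each variable
  separately (equivalent to joint holomorphy by Osgood's lemma).\<close>
definition holo3 :: "(cvec3 \<Rightarrow> complex) \<Rightarrow> cvec3 set \<Rightarrow> bool" where
  "holo3 F D \<longleftrightarrow> continuous_on D F \<and>
     (\<forall>u\<in>D. \<forall>k\<in>{1,2,3}. (\<lambda>t. F (upd3 k t u)) field_differentiable (at 0))"

definition curve_path ::
  "(nat \<Rightarrow> complex) \<Rightarrow> (real \<Rightarrow> complex) \<Rightarrow> (real \<Rightarrow> complex) \<Rightarrow>
     complex \<times> complex \<Rightarrow> complex \<times> complex \<Rightarrow> bool" where
  "curve_path a gx gy P Q \<longleftrightarrow> valid_path gx \<and> continuous_on {0..1} gy \<and>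
     (\<forall>t\<in>{0..1}. (gy t)\<^sup>2 = fC a (gx t) \<and> gy t \<noteq> 0) \<and>
     (gx 0, gy 0) = P \<and> (gx 1, gy 1) = Q"

definition abel_int :: "(real \<Rightarrow> complex) \<Rightarrow> (real \<Rightarrow> complex) \<Rightarrow> nat \<Rightarrow> complex" where
  "abel_int gx gy k = integral {0..1} (\<lambda>t. vector_derivative gx (at t) * gx t ^ (k - 1) / gy t)"

definition abel :: "(real \<Rightarrow> complex) \<Rightarrow> (real \<Rightarrow> complex) \<Rightarrow> cvec3" where
  "abel gx gy = (abel_int gx gy 1, abel_int gx gy 2, abel_int gx gy 3)"

text \<open>The matrix h (indices 0..4), in terms of a and the values p i j = wp_ij.\<close>
definition hmat :: "(nat \<Rightarrow> complex) \<Rightarrow> (nat \<Rightarrow> nat \<Rightarrow> complex) \<Rightarrow> nat \<Rightarrow> nat \<Rightarrow> complex" where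
  "hmat a p i j =
    [[a 0, 4 * a 1, 6 * a 2 - 2 * p 1 1, 4 * a 3 - 2 * p 1 2, a 4 - 2 * p 1 3],
     [4 * a 1, 16 * a 2 + 4 * p 1 1, 24 * a 3 + 2 * p 1 2, 16 * a 4 - 2 * p 2 2 + 4 * p 1 3, 4 * a 5 - 2 * p 2 3],
     [6 * a 2 - 2 * p 1 1, 24 * a 3 + 2 * p 1 2, 36 * a 4 + 4 * p 2 2 - 4 * p 1 3, 24 * a 5 + 2 * p 2 3, 6 * a 6 - 2 * p 3 3],
     [4 * a 3 - 2 * p 1 2, 16 * a 4 - 2 * p 2 2 + 4 * p 1 3, 24 * a 5 + 2 * p 2 3, 16 * a 6 + 4 * p 3 3, 4 * a 7],
     [a 4 - 2 * p 1 3, 4 * a 5 - 2 * p 2 3, 6 * a 6 - 2 * p 3 3, 4 * a 7, a 8]] ! i ! j"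

text \<open>The antisymmetric matrix A (indices 0..4), q i j k = wp_ijk.\<close>
definition Amat :: "(nat \<Rightarrow> nat \<Rightarrow> nat \<Rightarrow> complex) \<Rightarrow> nat \<Rightarrow> nat \<Rightarrow> complex" where
  "Amat q i j =
    [[0, - q 3 3 3, q 2 3 3, - q 2 2 3 + q 1 3 3, q 2 2 2 - 2 * q 1 2 3],
     [q 3 3 3, 0, - q 1 3 3, q 1 2 3, - q 1 2 2 + q 1 1 3],
     [- q 2 3 3, q 1 3 3, 0, - q 1 1 3, q 1 1 2],
     [q 2 2 3 - q 1 3 3, - q 1 2 3, q 1 1 3, 0, - q 1 1 1],
     [- q 2 2 2 + 2 * q 1 2 3, q 1 2 2 - q 1 1 3, - q 1 1 2, q 1 1 1, 0]] ! i ! j"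

definition hform :: "(nat \<Rightarrow> nat \<Rightarrow> complex) \<Rightarrow> complex \<Rightarrow> complex \<Rightarrow> complex" where
  "hform H x x' = (\<Sum>i<5. \<Sum>j<5. x ^ i * H i j * x' ^ j)"

end

theory Submission
  imports Defs "HOL-Complex_Analysis.Complex_Analysis" "HOL-Computational_Algebra.Computational_Algebra"
begin

text \<open>
  Four points \<open>(x\<^sub>i, y\<^sub>i)\<close> with distinct abscissae give a factorization \<open>f = L\<^sup>2 + K W\<close> into quartics, with
  \<open>W = \<Prod>(x - x\<^sub>i)\<close> and \<open>L(x\<^sub>i) = y\<^sub>i\<close>. The relations \<open>y\<^sub>i y\<^sub>j = h(x\<^sub>i, x\<^sub>j)\<close> force
  \<open>h = L L\<^sup>T + (K W\<^sup>T + W K\<^sup>T) / 2\<close>. Moving one point at a time and differentiating these relations, the third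
  derivatives turn out to be the \<open>3 \<times> 3\<close> minors of the matrix with rows \<open>L, K, W\<close> expanded in Schur functions;
  hence \<open>A\<close> is the Hodge dual of \<open>L \<and> K \<and> W\<close> and is annihilated by \<open>h\<close>.

  This gives \<open>h A = 0\<close> at the points \<open>u\<close> that are sums of four Abelian integrals, and one needs that these are
  dense in \<open>\<complex>\<^sup>3\<close>, a weak form of Jacobi inversion. The roots of \<open>M\<^sub>s = s\<^sup>2 K - 2 s L - W\<close> with ordinates
  \<open>y = s K - L\<close> form a pencil of equivalent divisors (Abel's theorem), and a generic point of the curve lies on
  a member of the pencil. So, up to closure, the set of sums is stable under translation by \<open>\<integral>(1, x, x\<^sup>2) dx / y\<close>
  along any small arc, hence under all of \<open>\<complex>\<^sup>3\<close>.
\<close>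

section \<open>Abelian integrals along paths on the curve\<close>

text \<open>Four points on a curve of genus three are one more than the dimension of
  \<open>\<complex>^3\<close>: by Riemann-Roch their class moves in at least a one-parameter family.
  One point of the divisor can therefore be prescribed without changing the sum of the integrals,
  and then be moved alone; this takes the place of solving an inversion problem. All sums are
  vectors of \<open>\<complex>^3\<close> attached to actual paths, dragged along as the divisor
  moves, so the period lattice never enters.

  The obstacle is degeneration: the relations can be exploited only for four distinct finite
  abscissae with nonzero ordinates. The bad positions are finite in number at every stage. They are
  avoided because the plane minus a finite set is connected, or absorbed by a limit, which is why
  closures appear.

  The count behind the algebra: a symmetric \<open>5 \<times> 5\<close> matrix has 15 entries, the
  coefficients of \<open>f\<close> fix the nine antidiagonal sums, and the six remaining parameters,
  the \<open>\<wp>\<^sub>i\<^sub>j\<close>, face the six pairs among four points.\<close>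

definition coord3 :: "nat \<Rightarrow> cvec3 \<Rightarrow> complex" where
  "coord3 k v = (if k = 1 then fst v else if k = 2 then fst (snd v) else snd (snd v))"

lemma coord3_simps [simp]:
  "coord3 (Suc 0) (p, q, r) = p" "coord3 2 (p, q, r) = q" "coord3 3 (p, q, r) = r"
  by (simp_all add: coord3_def)

lemma coord3_add [simp]: "coord3 k (u + v) = coord3 k u + coord3 k v"
  and coord3_diff [simp]: "coord3 k (u - v) = coord3 k u - coord3 k v"
  and coord3_zero [simp]: "coord3 k 0 = 0"
  by (auto simp: coord3_def)

lemma coord3_eqI: "(\<And>k. k \<in> {1,2,3} \<Longrightarrow> coord3 k u = coord3 k v) \<Longrightarrow> u = v"
  using coord3_simps by (cases u, cases v) (metis insertCI One_nat_def)

lemma coord3_sum: "coord3 k (\<Sum>i\<in>A. f i) = (\<Sum>i\<in>A. coord3 k (f i))"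
  by (induction A rule: infinite_finite_induct) auto

lemma add3_eq_plus: "add3 u v = u + v"
  by (simp add: add3_def plus_prod_def)

text \<open>The weight depends on the time and not only on the point \<open>g t\<close>: on the
  curve it contains the ordinate, which may differ between two visits to the same abscissa. So this
  is not the additivity of a contour integral of a function of the abscissa.\<close>

lemma has_integral_path_join:
  fixes g1 g2 w1 w2 :: "real \<Rightarrow> complex"
  assumes 1: "((\<lambda>t. w1 t * vector_derivative g1 (at t)) has_integral i1) {0..1}"
    and 2: "((\<lambda>t. w2 t * vector_derivative g2 (at t)) has_integral i2) {0..1}"
    and "valid_path g1" "valid_path g2"
  shows "((\<lambda>t. (w1 +++ w2) t * vector_derivative (g1 +++ g2) (at t)) has_integral (i1 + i2)) {0..1}"
proof -
  obtain s1 s2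
    where s1: "finite s1" "\<forall>x\<in>{0..1} - s1. g1 differentiable at x"
      and s2: "finite s2" "\<forall>x\<in>{0..1} - s2. g2 differentiable at x"
    using assms(3,4)
    by (auto simp: valid_path_def piecewise_C1_differentiable_on_def C1_differentiable_on_eq)
  have i1: "((\<lambda>x. (2 * w1 (2*x)) * vector_derivative g1 (at (2*x))) has_integral i1) {0..1/2}"
    and i2: "((\<lambda>x. (2 * w2 (2*x - 1)) * vector_derivative g2 (at (2*x - 1))) has_integral i2) {1/2..1}"
    using has_integral_affinity01 [OF 1, where m = 2 and c = 0, THEN has_integral_cmul [where c = 2]]
      has_integral_affinity01 [OF 2, where m = 2 and c = "-1", THEN has_integral_cmul [where c = 2]]
    by (simp_all only: image_affinity_atLeastAtMost_div_diff, simp_all add: scaleR_conv_of_real mult_ac)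
  have d1: "vector_derivative (g1 +++ g2) (at z) = 2 * vector_derivative g1 (at (2*z))"
    if "0 \<le> z" "2*z < 1" "2*z \<notin> s1" for z
  proof -
    have "((\<lambda>x. g1 (2*x)) has_vector_derivative 2 *\<^sub>R vector_derivative g1 (at (2*z))) (at z)"
      using s1 that vector_diff_chain_at [of "(*) 2" 2 z g1]
      by (auto simp: vector_derivative_works o_def has_real_derivative_iff_has_vector_derivative [symmetric]
               intro!: derivative_eq_intros)
    then have "((g1 +++ g2) has_vector_derivative 2 *\<^sub>R vector_derivative g1 (at (2*z))) (at z)"
      by (rule has_vector_derivative_transform_within_open [where S = "{..<1/2}"])
        (use that in \<open>auto simp: joinpaths_def\<close>)
    then show ?thesis
      by (simp add: vector_derivative_at scaleR_conv_of_real)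
  qed
  have d2: "vector_derivative (g1 +++ g2) (at z) = 2 * vector_derivative g2 (at (2*z - 1))"
    if "1 < 2*z" "z \<le> 1" "2*z - 1 \<notin> s2" for z
  proof -
    have "((\<lambda>x. g2 (2*x - 1)) has_vector_derivative 2 *\<^sub>R vector_derivative g2 (at (2*z - 1))) (at z)"
    proof (rule vector_diff_chain_at [of "\<lambda>x. 2*x - 1" 2 z g2, unfolded o_def])
      show "((\<lambda>x. 2*x - 1) has_vector_derivative 2) (at z)"
        unfolding has_real_derivative_iff_has_vector_derivative [symmetric]
        by (auto intro!: derivative_eq_intros)
    qed (use s2 that in \<open>auto simp: vector_derivative_works\<close>)
    then have "((g1 +++ g2) has_vector_derivative 2 *\<^sub>R vector_derivative g2 (at (2*z - 1))) (at z)"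
      by (rule has_vector_derivative_transform_within_open [where S = "{1/2<..}"])
        (use that in \<open>auto simp: joinpaths_def\<close>)
    then show ?thesis
      by (simp add: vector_derivative_at scaleR_conv_of_real)
  qed
  have "((\<lambda>t. (w1 +++ w2) t * vector_derivative (g1 +++ g2) (at t)) has_integral i1) {0..1/2}"
  proof (rule has_integral_spike_finite [OF _ _ i1])
    show "finite (insert (1/2) ((*) 2 -` s1))"
      using s1 by (force intro: finite_vimageI [where h = "(*)2"] inj_onI)
    fix x :: real
    assume x: "x \<in> {0..1/2} - insert (1/2) ((*) 2 -` s1)"
    then show "(w1 +++ w2) x * vector_derivative (g1 +++ g2) (at x) =
        2 * w1 (2*x) * vector_derivative g1 (at (2*x))"
      using d1 [of x] by (simp add: joinpaths_def [of w1])
  qed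
  moreover have "((\<lambda>t. (w1 +++ w2) t * vector_derivative (g1 +++ g2) (at t)) has_integral i2) {1/2..1}"
  proof (rule has_integral_spike_finite [OF _ _ i2])
    show "finite (insert (1/2) ((\<lambda>x. 2*x - 1) -` s2))"
      using s2 by (force intro: finite_vimageI [where h = "\<lambda>x. 2*x-1"] inj_onI)
    fix x :: real
    assume x: "x \<in> {1/2..1} - insert (1/2) ((\<lambda>x. 2*x - 1) -` s2)"
    then show "(w1 +++ w2) x * vector_derivative (g1 +++ g2) (at x) =
        2 * w2 (2*x - 1) * vector_derivative g2 (at (2*x - 1))"
      using d2 [of x] by (simp add: joinpaths_def [of w1])
  qed
  ultimately show ?thesis
    by (simp add: has_integral_combine [where c = "1/2"])
qed

text \<open>The integrals are required to exist: a valid path may have an unbounded derivative, and the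
  integral in \<open>abel_int\<close> is \<open>0\<close> when the integrand is not integrable.\<close>
definition reach :: "(nat \<Rightarrow> complex) \<Rightarrow> complex \<times> complex \<Rightarrow> complex \<Rightarrow> complex \<Rightarrow> cvec3 \<Rightarrow> bool" where
  "reach a P x y v \<longleftrightarrow> (\<exists>gx gy. curve_path a gx gy P (x, y) \<and>
     (\<forall>k\<in>{1,2,3}. ((\<lambda>t. gx t ^ (k - 1) / gy t * vector_derivative gx (at t)) has_integral coord3 k v) {0..1}))"

text \<open>A chart of the curve away from its branch points, together with the Abel map on it:
  \<open>\<Phi>\<close> is a primitive of \<open>(1, x, x^2) dx / y\<close>. Convexity makes
  straight segments available as paths.\<close>

definition local_branch ::
  "(nat \<Rightarrow> complex) \<Rightarrow> complex set \<Rightarrow> (complex \<Rightarrow> complex) \<Rightarrow> (complex \<Rightarrow> cvec3) \<Rightarrow> bool" where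
  "local_branch a U Y \<Phi> \<longleftrightarrow> open U \<and> convex U \<and> Y holomorphic_on U \<and>
     (\<forall>z\<in>U. (Y z)\<^sup>2 = fC a z \<and> Y z \<noteq> 0) \<and>
     (\<forall>z\<in>U. \<forall>k\<in>{1,2,3}. ((\<lambda>z. coord3 k (\<Phi> z)) has_field_derivative z ^ (k - 1) / Y z) (at z))"

lemma reach_imp_abel:
  assumes "reach a P x y v"
  obtains gx gy where "curve_path a gx gy P (x, y)" "abel gx gy = v"
proof -
  from assms obtain gx gy where g: "curve_path a gx gy P (x, y)"
    and i: "\<And>k. k \<in> {1,2,3} \<Longrightarrow> ((\<lambda>t. gx t ^ (k - 1) / gy t * vector_derivative gx (at t)) has_integral coord3 k v) {0..1}"
    unfolding reach_def by blast
  have "abel_int gx gy k = coord3 k v" if "k \<in> {1,2,3}" for k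
    using integral_unique [OF i [OF that]] by (simp add: abel_int_def mult_ac)
  from this [of 1] this [of 2] this [of 3] have "abel gx gy = v"
    by (simp add: abel_def coord3_def prod_eq_iff)
  with g that show thesis by blast
qed

lemma reach_point: "reach a P x y v \<Longrightarrow> y\<^sup>2 = fC a x \<and> y \<noteq> 0"
  unfolding reach_def curve_path_def by force

lemma reach_refl:
  assumes "y\<^sup>2 = fC a x" "y \<noteq> 0"
  shows "reach a (x, y) x y 0"
  unfolding reach_def curve_path_def using assms valid_path_linepath [of x x]
  by (intro exI [of _ "\<lambda>_. x"] exI [of _ "\<lambda>_. y"]) (auto simp: linepath_refl)

text \<open>The path is prolonged by the segment from \<open>z\<close> to \<open>w\<close>, lifted
  to the curve by \<open>Y\<close>. Its contribution depends only on the end points because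
  \<open>\<Phi>\<close> is a primitive.\<close>

lemma reach_extend:
  assumes br: "local_branch a U Y \<Phi>" and zw: "z \<in> U" "w \<in> U" and r: "reach a P z (Y z) v"
  shows "reach a P w (Y w) (v + \<Phi> w - \<Phi> z)"
proof -
  from r obtain gx gy where g: "curve_path a gx gy P (z, Y z)"
    and i: "\<And>k. k \<in> {1,2,3} \<Longrightarrow> ((\<lambda>t. gx t ^ (k - 1) / gy t * vector_derivative gx (at t)) has_integral coord3 k v) {0..1}"
    unfolding reach_def by blast
  let ?l = "linepath z w"
  have seg: "?l t \<in> U" if "t \<in> {0..1}" for t
    using that zw br unfolding local_branch_def linepath_def
    by (auto intro!: convexD)
  have j: "((\<lambda>t. ?l t ^ (k - 1) / Y (?l t) * vector_derivative ?l (at t)) has_integral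
        (coord3 k (\<Phi> w) - coord3 k (\<Phi> z))) {0..1}" if k: "k \<in> {1,2,3}" for k
  proof -
    have "((\<lambda>t. coord3 k (\<Phi> (?l t))) has_vector_derivative (?l t ^ (k - 1) / Y (?l t) * (w - z))) (at t within {0..1})"
      if "t \<in> {0..1}" for t
    proof -
      have "((\<lambda>z. coord3 k (\<Phi> z)) has_field_derivative ?l t ^ (k - 1) / Y (?l t)) (at (?l t))"
        using br seg [OF that] k unfolding local_branch_def by blast
      from field_vector_diff_chain_at [OF has_vector_derivative_linepath_within [of z w t UNIV] this]
      show ?thesis by (auto simp: o_def mult_ac intro: has_vector_derivative_at_within)
    qed
    from fundamental_theorem_of_calculus [OF zero_le_one this] show ?thesis
      by (simp add: linepath_1' linepath_0')
  qed
  have *: "gx 1 = z" "gy 1 = Y z" "(gx 0, gy 0) = P" "valid_path gx" "continuous_on {0..1} gy"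
      "\<forall>t\<in>{0..1}. (gy t)\<^sup>2 = fC a (gx t) \<and> gy t \<noteq> 0"
    using g unfolding curve_path_def by auto
  have cY: "continuous_on {0..1} (\<lambda>t. Y (?l t))"
  proof (rule continuous_on_compose2 [of U Y])
    show "continuous_on U Y"
      using br unfolding local_branch_def by (blast intro: holomorphic_on_imp_continuous_on)
  qed (use seg in \<open>auto intro: continuous_on_linepath\<close>)
  let ?gx = "gx +++ ?l" and ?gy = "gy +++ (\<lambda>t. Y (?l t))"
  have "path ?gy"
    using * cY by (intro path_join_imp) (auto simp: path_def pathfinish_def pathstart_def linepath_def)
  moreover have "(?gy t)\<^sup>2 = fC a (?gx t) \<and> ?gy t \<noteq> 0" if "t \<in> {0..1}" for t
    using * that br seg unfolding local_branch_def joinpaths_def by auto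
  moreover have "valid_path ?gx"
    using * by (intro valid_path_join) (auto simp: pathfinish_def)
  ultimately have "curve_path a ?gx ?gy P (w, Y w)"
    using * unfolding curve_path_def path_def by (auto simp: joinpaths_def linepath_def)
  moreover have "((\<lambda>t. ?gx t ^ (k - 1) / ?gy t * vector_derivative ?gx (at t)) has_integral coord3 k (v + \<Phi> w - \<Phi> z)) {0..1}"
    if k: "k \<in> {1,2,3}" for k
  proof -
    have eq: "?gx t ^ (k - 1) / ?gy t = ((\<lambda>t. gx t ^ (k - 1) / gy t) +++ (\<lambda>t. ?l t ^ (k - 1) / Y (?l t))) t" for t
      by (auto simp: joinpaths_def)
    show ?thesis
      unfolding eq using has_integral_path_join [OF i [OF k] j [OF k]] * by (simp add: add_diff_eq)
  qed
  ultimately show ?thesis unfolding reach_def by blast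
qed

lemma holomorphic_on_fC: "fC a holomorphic_on S"
  unfolding fC_def [abs_def] by (intro holomorphic_intros)

lemma local_branch_exists:
  assumes y: "y\<^sup>2 = fC a x" "y \<noteq> 0"
  obtains r Y \<Phi> where "r > 0" "local_branch a (ball x r) Y \<Phi>" "Y x = y"
proof -
  have "continuous_on UNIV (fC a)"
    using holomorphic_on_fC holomorphic_on_imp_continuous_on by blast
  then have "open (fC a -` (-{0}))"
    by (intro open_vimage) (auto simp: continuous_on_eq_continuous_at)
  moreover have "x \<in> fC a -` (-{0})"
    using y by auto
  ultimately obtain r where r: "r > 0" "ball x r \<subseteq> fC a -` (-{0})"
    using open_contains_ball by metis
  then have nz: "\<And>z. z \<in> ball x r \<Longrightarrow> fC a z \<noteq> 0" by auto
  obtain g where g: "g holomorphic_on ball x r" "\<And>z. z \<in> ball x r \<Longrightarrow> fC a z = (g z)\<^sup>2"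
    using contractible_imp_holomorphic_sqrt [OF holomorphic_on_fC _ nz] convex_imp_contractible convex_ball
    by metis
  have gx: "g x = y \<or> g x = - y"
    using y g(2) [of x] r by (metis centre_in_ball power2_eq_iff)
  \<comment> \<open>The factor \<open>g x / y\<close> is \<open>1\<close> or \<open>-1\<close> and
    selects the square root with value \<open>y\<close> at \<open>x\<close>.\<close>
  define Y where "Y z = g z * (g x / y)" for z
  have Y: "Y x = y" "Y holomorphic_on ball x r"
    using gx y g(1) unfolding Y_def by (auto intro!: holomorphic_intros)
  have Y2: "(Y z)\<^sup>2 = fC a z" "Y z \<noteq> 0" if "z \<in> ball x r" for z
    using gx g(2) [OF that] nz [OF that] y unfolding Y_def by (auto simp: power_mult_distrib power_divide)
  have "\<exists>p. \<forall>z\<in>ball x r. (p has_field_derivative z ^ (k - 1) / Y z) (at z)" for k :: nat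
  proof -
    have "(\<lambda>z. z ^ (k - 1) / Y z) holomorphic_on ball x r"
      using Y Y2 by (auto intro!: holomorphic_intros)
    from holomorphic_convex_primitive' [OF convex_ball open_ball this]
    obtain p where "\<And>z. z \<in> ball x r \<Longrightarrow> (p has_field_derivative z ^ (k - 1) / Y z) (at z within ball x r)"
      by blast
    then show ?thesis using at_within_open [OF _ open_ball] by metis
  qed
  then obtain p where p: "\<And>k z. z \<in> ball x r \<Longrightarrow> (p k has_field_derivative z ^ (k - 1) / Y z) (at z)"
    by metis
  have "local_branch a (ball x r) Y (\<lambda>z. (p 1 z, p 2 z, p 3 z))"
    unfolding local_branch_def using Y Y2 p[of _ 1] p[of _ 2] p[of _ 3] by (auto simp: coord3_def)
  with Y r that show thesis by blast
qed

section \<open>Interpolation polynomials\<close>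

definition root_poly :: "complex set \<Rightarrow> complex poly" where
  "root_poly Z = (\<Prod>z\<in>Z. [:-z, 1:])"

lemma poly_root_poly: "finite Z \<Longrightarrow> poly (root_poly Z) x = 0 \<longleftrightarrow> x \<in> Z"
  by (auto simp: root_poly_def poly_prod)

lemma degree_root_poly [simp]: "degree (root_poly Z) = card Z"
  by (simp add: root_poly_def degree_prod_sum_eq)

lemma lead_coeff_root_poly: "lead_coeff (root_poly Z) = 1"
  by (simp add: root_poly_def lead_coeff_prod del: degree_root_poly)

lemma interpolation_poly_exists:
  fixes g :: "complex \<Rightarrow> complex"
  assumes "finite Z"
  shows "\<exists>L. (\<forall>z\<in>Z. poly L z = g z) \<and> degree L \<le> card Z - 1"
  using assms
proof (induction Z)
  case empty
  show ?case by (intro exI [of _ 0]) auto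
next
  case (insert x Z)
  then obtain L where L: "\<forall>z\<in>Z. poly L z = g z" "degree L \<le> card Z - 1" by blast
  \<comment> \<open>Newton interpolation: a multiple of \<open>root_poly Z\<close> corrects the
    value at the new node and changes nothing at the old ones.\<close>
  define c where "c = (g x - poly L x) / poly (root_poly Z) x"
  have "poly (root_poly Z) x \<noteq> 0"
    using insert by (simp add: poly_root_poly)
  then have "poly (L + smult c (root_poly Z)) z = g z" if "z \<in> insert x Z" for z
    using that L insert poly_root_poly [of Z z] by (auto simp: c_def)
  moreover have "degree (L + smult c (root_poly Z)) \<le> card Z"
    using L by (intro degree_add_le) auto
  ultimately show ?case using insert by (intro exI [of _ "L + smult c (root_poly Z)"]) auto
qed

lemma root_poly_dvd:
  assumes "finite Z" "\<And>z. z \<in> Z \<Longrightarrow> poly p z = 0"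
  shows "root_poly Z dvd p"
  using assms
proof (induction Z)
  case empty
  show ?case by (simp add: root_poly_def)
next
  case (insert x Z)
  then obtain q where q: "p = root_poly Z * q" by (auto elim: dvdE)
  have "poly (root_poly Z) x * poly q x = 0"
    using insert.prems [of x] q by simp
  moreover have "poly (root_poly Z) x \<noteq> 0"
    using insert.hyps by (simp add: poly_root_poly)
  ultimately have "[:-x, 1:] dvd q"
    by (simp flip: poly_eq_0_iff_dvd)
  then have "[:-x, 1:] * root_poly Z dvd root_poly Z * q"
    using mult_dvd_mono [of "[:-x, 1:]" q "root_poly Z" "root_poly Z"] by (metis dvd_refl mult.commute)
  then show ?case using insert q by (simp add: root_poly_def)
qed

lemma card_roots_rsquarefree:
  fixes p :: "complex poly"
  assumes "rsquarefree p"
  shows "card {z. poly p z = 0} = degree p" "p = smult (lead_coeff p) (root_poly {z. poly p z = 0})"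
proof -
  show eq: "p = smult (lead_coeff p) (root_poly {z. poly p z = 0})"
    using complex_poly_decompose_rsquarefree [OF assms] by (simp add: root_poly_def)
  have "p \<noteq> 0" using assms by (simp add: rsquarefree_def)
  then show "card {z. poly p z = 0} = degree p"
    using arg_cong [OF eq, of degree] by simp
qed

text \<open>Euler's identity: the summands are the residues of \<open>x^j / p\<close>, whose sum
  vanishes when the degree of \<open>p\<close> exceeds \<open>j\<close> by at least two. The range
  \<open>j \<le> 2\<close> matches the three holomorphic differentials, so this is the algebraic
  core of Abel's theorem here.\<close>

lemma sum_powers_over_derivative_eq_0:
  fixes p :: "complex poly"
  assumes "card Z = 4" "p = smult c (root_poly Z)" "c \<noteq> 0" "j \<le> 2"
  shows "(\<Sum>z\<in>Z. z ^ j / poly (pderiv p) z) = 0"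
proof -
  have "card Z = Suc (Suc (Suc (Suc 0)))" using assms(1) by simp
  then obtain z1 z2 z3 z4 where Z: "Z = {z1, z2, z3, z4}"
    and d: "z1 \<noteq> z2" "z1 \<noteq> z3" "z1 \<noteq> z4" "z2 \<noteq> z3" "z2 \<noteq> z4" "z3 \<noteq> z4"
    by (auto simp: card_Suc_eq)
  define d12 d13 d14 d23 d24 d34 where dd: "d12 = z1 - z2" "d13 = z1 - z3" "d14 = z1 - z4"
    "d23 = z2 - z3" "d24 = z2 - z4" "d34 = z3 - z4"
  have nz: "d12 \<noteq> 0" "d13 \<noteq> 0" "d14 \<noteq> 0" "d23 \<noteq> 0" "d24 \<noteq> 0" "d34 \<noteq> 0"
    using d by (auto simp: dd)
  have p: "p = smult c ([:-z1, 1:] * ([:-z2, 1:] * ([:-z3, 1:] * [:-z4, 1:])))"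
    using assms(2) d by (simp add: Z root_poly_def)
  have p1: "poly (pderiv p) z1 = c * d12 * d13 * d14" "poly (pderiv p) z2 = - (c * d12 * d23 * d24)"
    "poly (pderiv p) z3 = c * d13 * d23 * d34" "poly (pderiv p) z4 = - (c * d14 * d24 * d34)"
    unfolding p dd pderiv_smult pderiv_mult by (simp_all add: pderiv_pCons) algebra+
  have "(\<Sum>z\<in>Z. z ^ j / poly (pderiv p) z) =
      (z1^j * d23 * d24 * d34 - z2^j * d13 * d14 * d34 + z3^j * d12 * d14 * d24 - z4^j * d12 * d13 * d23)
        / (c * d12 * d13 * d14 * d23 * d24 * d34)"
    using d nz \<open>c \<noteq> 0\<close> unfolding Z by (simp add: p1 field_simps)
  also have "z1^j * d23 * d24 * d34 - z2^j * d13 * d14 * d34 + z3^j * d12 * d14 * d24 - z4^j * d12 * d13 * d23 = 0"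
  proof -
    have "j = 0 \<or> j = 1 \<or> j = 2" using \<open>j \<le> 2\<close> by linarith
    then show ?thesis
    proof (elim disjE)
      assume "j = 0"
      then show ?thesis unfolding dd by (simp add: algebra_simps)
    next
      assume "j = 1"
      then show ?thesis unfolding dd by (simp add: algebra_simps)
    next
      assume "j = 2"
      then show ?thesis unfolding dd by (simp add: algebra_simps power2_eq_square)
    qed
  qed
  finally show ?thesis by simp
qed

section \<open>The polynomial of the curve and its factorizations\<close>

definition fpoly :: "(nat \<Rightarrow> complex) \<Rightarrow> complex poly" where
  "fpoly a = (\<Sum>i\<le>8. monom (of_nat (8 choose i) * a i) i)"

lemma poly_fpoly: "poly (fpoly a) x = fC a x"
  by (simp add: fpoly_def fC_def poly_sum poly_monom)

lemma coeff_fpoly: "coeff (fpoly a) n = (if n \<le> 8 then of_nat (8 choose n) * a n else 0)"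
  by (simp add: fpoly_def coeff_sum)

lemma poly_pderiv_fpoly: "poly (pderiv (fpoly a)) x = fC' a x"
proof -
  have pderiv_sum: "pderiv (\<Sum>i\<in>A. g i) = (\<Sum>i\<in>A. pderiv (g i))" for A and g :: "nat \<Rightarrow> complex poly"
    by (induction A rule: infinite_finite_induct) (auto simp: pderiv_add)
  have "poly (pderiv (fpoly a)) x = (\<Sum>i\<le>8. of_nat i * (of_nat (8 choose i) * a i) * x ^ (i - 1))"
    using pderiv_sum by (simp add: fpoly_def poly_sum pderiv_monom poly_monom)
  also have "\<dots> = (\<Sum>i\<in>{1..8}. of_nat i * (of_nat (8 choose i) * a i) * x ^ (i - 1))"
    by (rule sum.mono_neutral_right) auto
  finally show ?thesis by (simp add: fC'_def mult_ac)
qed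

lemma degree_fpoly_le: "degree (fpoly a) \<le> 8"
  by (intro degree_le) (auto simp: coeff_fpoly)

text \<open>The interpolating cubic makes \<open>f - L^2\<close> vanish on \<open>Z\<close>, so
  \<open>root_poly Z\<close> divides it. As \<open>L^2\<close> has degree at most six, the leading
  term of \<open>f\<close> survives, and the cofactor has degree exactly four with leading
  coefficient \<open>a 8\<close>.\<close>

lemma interpolation_factorization:
  assumes a8: "a 8 \<noteq> 0" and Z: "card Z = 4" and \<eta>: "\<And>z. z \<in> Z \<Longrightarrow> (\<eta> z)\<^sup>2 = fC a z"
  obtains L K where "fpoly a = L\<^sup>2 + K * root_poly Z" "degree L \<le> 3" "degree K = 4" "coeff K 4 = a 8"
    "\<And>z. z \<in> Z \<Longrightarrow> poly L z = \<eta> z"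
proof -
  have fin: "finite Z" using Z card.infinite by fastforce
  obtain L where L: "\<And>z. z \<in> Z \<Longrightarrow> poly L z = \<eta> z" "degree L \<le> 3"
    using interpolation_poly_exists [OF fin, of \<eta>] Z by auto
  have "root_poly Z dvd fpoly a - L\<^sup>2"
    using fin L \<eta> by (intro root_poly_dvd) (auto simp: poly_fpoly)
  then obtain K where K: "fpoly a - L\<^sup>2 = root_poly Z * K" by (auto elim: dvdE)
  have dL: "degree (L\<^sup>2) \<le> 6"
    using degree_power_le [of L 2] L by linarith
  have c8: "coeff (fpoly a - L\<^sup>2) 8 = a 8"
    using dL by (simp add: coeff_fpoly coeff_eq_0)
  have "degree (fpoly a - L\<^sup>2) = 8"
  proof (rule antisym)
    show "degree (fpoly a - L\<^sup>2) \<le> 8"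
      using dL degree_fpoly_le by (intro degree_diff_le) auto
    show "8 \<le> degree (fpoly a - L\<^sup>2)"
      using a8 c8 by (intro le_degree) simp
  qed
  moreover have "root_poly Z \<noteq> 0" "K \<noteq> 0"
    using Z calculation K by auto
  ultimately have dK: "degree K = 4"
    using K Z by (simp add: degree_mult_eq)
  have "coeff K 4 = a 8"
    using c8 coeff_mult_degree_sum [of "root_poly Z" K] lead_coeff_root_poly [of Z] Z dK
    unfolding K by simp
  moreover have "fpoly a = L\<^sup>2 + K * root_poly Z" using K by (simp add: algebra_simps)
  ultimately show thesis using that L dK by blast
qed

section \<open>The pencil of degree four divisors\<close>

locale pencil =
  fixes a :: "nat \<Rightarrow> complex" and L K W :: "complex poly"
  assumes nonsing: "\<And>x. fC a x = 0 \<Longrightarrow> fC' a x \<noteq> 0"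
    and a8: "a 8 \<noteq> 0"
    and factorization: "fpoly a = L\<^sup>2 + K * W"
    and degrees: "degree L \<le> 3" "degree K = 4" "degree W = 4"
    and lead_coeffs: "coeff K 4 = a 8" "coeff W 4 = 1"
begin

text \<open>Substituting \<open>y = s K - L\<close> in the curve gives
  \<open>(s K - L)^2 - f = K M_s\<close>: after removal of the fixed points over
  \<open>K = 0\<close>, the roots of \<open>M_s\<close> are the remaining intersections. As a
  quadratic in \<open>s\<close> it has discriminant \<open>4 f\<close>. The value
  \<open>s = 0\<close> gives back the roots of \<open>W\<close>, with ordinates
  \<open>- L\<close>.\<close>

definition M :: "complex \<Rightarrow> complex poly" where
  "M s = smult (s\<^sup>2) K - smult (2 * s) L - W"

definition ord :: "complex \<Rightarrow> complex \<Rightarrow> complex" where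
  "ord s x = s * poly K x - poly L x"

text \<open>Parameters whose divisor degenerates. The coefficient of \<open>x^4\<close> in
  \<open>M s\<close> is \<open>s^2 * a 8 - 1\<close>, so the first clause is the escape of a root to
  infinity; the others are a collision of roots and a root over a branch point.\<close>

definition exceptional :: "complex set" where
  "exceptional = {s. s\<^sup>2 * a 8 = 1 \<or>
     (\<exists>x. poly (M s) x = 0 \<and> (poly (pderiv (M s)) x = 0 \<or> fC a x = 0))}"

lemma fC_eq: "fC a x = (poly L x)\<^sup>2 + poly K x * poly W x"
  by (simp flip: poly_fpoly add: factorization)

lemma fC'_eq: "fC' a x = 2 * poly L x * poly (pderiv L) x + poly (pderiv K) x * poly W x
    + poly K x * poly (pderiv W) x"
  by (simp flip: poly_pderiv_fpoly add: factorization pderiv_add pderiv_mult power2_eq_square algebra_simps)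

lemma poly_M: "poly (M s) x = s\<^sup>2 * poly K x - 2 * s * poly L x - poly W x"
  by (simp add: M_def)

lemma poly_pderiv_M:
  "poly (pderiv (M s)) x = s\<^sup>2 * poly (pderiv K) x - 2 * s * poly (pderiv L) x - poly (pderiv W) x"
  by (simp add: M_def pderiv_diff pderiv_smult)

lemma ord_sq: "poly (M s) x = 0 \<Longrightarrow> (ord s x)\<^sup>2 = fC a x"
  unfolding poly_M ord_def fC_eq by algebra

text \<open>\<open>f = L^2 + K W\<close> is quadratic in the three polynomials, so a common zero
  would be a multiple root of \<open>f\<close>.\<close>

lemma no_common_zero: "\<not> (poly K x = 0 \<and> poly L x = 0 \<and> poly W x = 0)"
  using nonsing [of x] by (auto simp: fC_eq fC'_eq)

lemma finite_parameters: "finite {s. poly (M s) x = 0}"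
proof -
  have "[:- poly W x, - 2 * poly L x, poly K x:] \<noteq> 0"
    using no_common_zero [of x] by auto
  from poly_roots_finite [OF this] show ?thesis
    by (simp add: poly_M power2_eq_square algebra_simps)
qed

lemma rsquarefree_fpoly: "rsquarefree (fpoly a)"
  using nonsing unfolding rsquarefree_roots by (auto simp: poly_fpoly poly_pderiv_fpoly)

lemma degree_fpoly: "degree (fpoly a) = 8"
  using a8 by (intro antisym degree_fpoly_le le_degree) (simp add: coeff_fpoly)

text \<open>If a double root occurs over \<open>x\<close> then, since \<open>K s = L + y\<close>, the value
  \<open>K\<^sup>2 M\<^sub>s' = p1 + y p2\<close> vanishes, so \<open>p1\<^sup>2 = f p2\<^sup>2\<close> at \<open>x\<close>.\<close>
lemma finite_exceptional: "finite exceptional"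
proof -
  define p1 where "p1 = pderiv K * (L\<^sup>2 + fpoly a) - 2 * pderiv L * K * L - pderiv W * K\<^sup>2"
  define p2 where "p2 = 2 * pderiv K * L - 2 * pderiv L * K"
  define E where "E = {x. poly (fpoly a) x = 0} \<union> {x. poly K x = 0} \<union> {x. poly (p1\<^sup>2 - fpoly a * p2\<^sup>2) x = 0}"
  have K0: "K \<noteq> 0" and f0: "fpoly a \<noteq> 0" using degrees degree_fpoly by auto
  \<comment> \<open>The aim is to see that \<open>p1^2 - f p2^2\<close> is not identically zero.
    Eight distinct roots of \<open>f\<close> against at most four of \<open>K\<close> leave a root
    \<open>e\<close> of \<open>f\<close> with \<open>K(e) \<noteq> 0\<close>, and there the value is
    \<open>(K f')^2\<close>.\<close>
  have "card {x. poly K x = 0} \<le> 4"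
    using card_poly_roots_bound [OF K0] degrees by simp
  moreover have "card {x. poly (fpoly a) x = 0} = 8"
    using card_roots_rsquarefree(1) [OF rsquarefree_fpoly] degree_fpoly by simp
  ultimately have "\<not> {x. poly (fpoly a) x = 0} \<subseteq> {x. poly K x = 0}"
    using card_mono [OF poly_roots_finite [OF K0], of "{x. poly (fpoly a) x = 0}"] by linarith
  then obtain e where e: "fC a e = 0" "poly K e \<noteq> 0"
    by (auto simp: poly_fpoly)
  have "poly p1 e = - poly K e * fC' a e"
  proof -
    have l: "(poly L e)\<^sup>2 + poly K e * poly W e = 0" using e(1) by (simp add: fC_eq)
    have "poly p1 e = poly (pderiv K) e * (poly L e)\<^sup>2 - 2 * poly (pderiv L) e * poly K e * poly L e
        - poly (pderiv W) e * (poly K e)\<^sup>2"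
      by (simp add: p1_def poly_fpoly e(1))
    also have "\<dots> = - poly K e * fC' a e"
      using l unfolding fC'_eq by algebra
    finally show ?thesis .
  qed
  then have "poly (p1\<^sup>2 - fpoly a * p2\<^sup>2) e \<noteq> 0"
    using e nonsing by (simp add: poly_fpoly)
  then have "p1\<^sup>2 - fpoly a * p2\<^sup>2 \<noteq> 0" by force
  then have "finite E"
    using poly_roots_finite K0 f0 unfolding E_def by (intro finite_UnI) blast+
  moreover have "x \<in> E" if m: "poly (M s) x = 0" "poly (pderiv (M s)) x = 0 \<or> fC a x = 0" for s x
  proof (cases "fC a x = 0")
    case False
    with m have "poly (pderiv (M s)) x = 0" by blast
    then have d: "s\<^sup>2 * poly (pderiv K) x - 2 * s * poly (pderiv L) x - poly (pderiv W) x = 0"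
      by (simp only: poly_pderiv_M)
    have sK: "s * poly K x = poly L x + ord s x" by (simp add: ord_def)
    have y2: "(ord s x)\<^sup>2 = fC a x" by (rule ord_sq [OF m(1)])
    have "poly p1 x + ord s x * poly p2 x =
        (poly K x)\<^sup>2 * (s\<^sup>2 * poly (pderiv K) x - 2 * s * poly (pderiv L) x - poly (pderiv W) x)"
    proof -
      have "poly p1 x + ord s x * poly p2 x = poly (pderiv K) x * (poly L x + ord s x)\<^sup>2
          - 2 * poly (pderiv L) x * poly K x * (poly L x + ord s x) - poly (pderiv W) x * (poly K x)\<^sup>2"
        by (simp add: p1_def p2_def poly_fpoly y2 [symmetric] power2_eq_square algebra_simps)
      then show ?thesis
        unfolding sK [symmetric] by (simp add: power2_eq_square algebra_simps)
    qed
    with d have "poly p1 x = - (ord s x * poly p2 x)" by (simp add: eq_neg_iff_add_eq_0)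
    then have "(poly p1 x)\<^sup>2 = fC a x * (poly p2 x)\<^sup>2"
      by (simp add: power_mult_distrib y2)
    then show ?thesis by (simp add: E_def poly_fpoly)
  qed (simp add: E_def poly_fpoly)
  then have "exceptional \<subseteq> {s. s\<^sup>2 * a 8 = 1} \<union> (\<Union>x\<in>E. {s. poly (M s) x = 0})"
    unfolding exceptional_def by blast
  moreover have "finite {s. s\<^sup>2 * a 8 = 1}"
    using poly_roots_finite [of "[:-1, 0, a 8:]"] a8 by (simp add: power2_eq_square algebra_simps)
  ultimately show ?thesis
    using finite_parameters by (meson finite_UN finite_Un finite_subset)
qed

lemma degree_M: "s \<notin> exceptional \<Longrightarrow> degree (M s) = 4"
proof (rule antisym)
  show "degree (M s) \<le> 4"
    unfolding M_def using degrees by (intro degree_diff_le) auto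
  assume "s \<notin> exceptional"
  then have "coeff (M s) 4 \<noteq> 0"
    using degrees lead_coeffs by (simp add: M_def exceptional_def coeff_eq_0)
  then show "4 \<le> degree (M s)" by (rule le_degree)
qed

lemma rsquarefree_M: "s \<notin> exceptional \<Longrightarrow> rsquarefree (M s)"
  unfolding rsquarefree_roots exceptional_def by auto

lemma card_roots_M: "s \<notin> exceptional \<Longrightarrow> card {z. poly (M s) z = 0} = 4"
  using card_roots_rsquarefree(1) rsquarefree_M degree_M by simp

lemma sum_roots_M:
  assumes s: "s \<notin> exceptional" and "j \<le> 2"
  shows "(\<Sum>z | poly (M s) z = 0. z ^ j / poly (pderiv (M s)) z) = 0"
proof (rule sum_powers_over_derivative_eq_0 [OF card_roots_M [OF s]
    card_roots_rsquarefree(2) [OF rsquarefree_M [OF s]]])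
  show "lead_coeff (M s) \<noteq> 0" using degree_M [OF s] by (metis degree_0 leading_coeff_0_iff zero_neq_numeral)
qed fact

text \<open>On the curve the parameter is \<open>s = (L + y) / K = W / (y - L)\<close>; one of the two denominators
  is nonzero at any point with \<open>y \<noteq> 0\<close>.\<close>
lemma local_parameter:
  assumes br: "local_branch a U Y \<Phi>" and z: "z \<in> U" and m: "poly (M s0) z = 0" "Y z = ord s0 z"
  obtains V \<sigma> where "open V" "z \<in> V" "V \<subseteq> U" "\<sigma> holomorphic_on V" "\<sigma> z = s0"
    "\<And>x. x \<in> V \<Longrightarrow> poly (M (\<sigma> x)) x = 0 \<and> ord (\<sigma> x) x = Y x"
proof -
  have Y: "open U" "Y holomorphic_on U" "\<And>x. x \<in> U \<Longrightarrow> (Y x)\<^sup>2 = fC a x \<and> Y x \<noteq> 0"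
    using br unfolding local_branch_def by blast+
  have cY: "continuous_on U Y" using Y(2) holomorphic_on_imp_continuous_on by blast
  show thesis
  proof (cases "poly K z = 0")
    case False
    define V where "V = U \<inter> poly K -` (-{0})"
    have "open V" unfolding V_def
      by (auto intro!: continuous_open_preimage Y(1) continuous_intros)
    moreover have "(\<lambda>x. (poly L x + Y x) / poly K x) holomorphic_on V"
      using holomorphic_on_subset [OF Y(2), of V] unfolding V_def
      by (auto intro!: holomorphic_intros)
    moreover have "poly (M ((poly L x + Y x) / poly K x)) x = 0 \<and> ord ((poly L x + Y x) / poly K x) x = Y x"
      if "x \<in> V" for x
    proof -
      have k: "poly K x \<noteq> 0" and "(Y x)\<^sup>2 = (poly L x)\<^sup>2 + poly K x * poly W x"
        using that Y(3) [of x] by (auto simp: V_def fC_eq)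
      moreover define t where "t = (poly L x + Y x) / poly K x"
      then have t: "t * poly K x = poly L x + Y x" using k by simp
      ultimately have "poly K x * poly (M t) x = 0"
        unfolding poly_M by algebra
      with k t show ?thesis by (simp add: ord_def t_def)
    qed
    ultimately show thesis
      using False z m by (intro that [of V "\<lambda>x. (poly L x + Y x) / poly K x"]) (auto simp: V_def ord_def)
  next
    case True
    \<comment> \<open>Over a zero of \<open>K\<close> the ordinate is \<open>- L\<close>, so
      \<open>Y - L = - 2 L\<close> is nonzero and the second expression for the parameter
      applies.\<close>
    then have yz: "Y z = - poly L z" "poly L z \<noteq> 0" using m Y(3) [OF z] by (auto simp: ord_def)
    define V where "V = U \<inter> (\<lambda>x. Y x - poly L x) -` (-{0})"
    have "open V" unfolding V_def
      by (auto intro!: continuous_open_preimage Y(1) continuous_intros cY)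
    moreover have "(\<lambda>x. poly W x / (Y x - poly L x)) holomorphic_on V"
      using holomorphic_on_subset [OF Y(2), of V] unfolding V_def
      by (auto intro!: holomorphic_intros)
    moreover have "poly (M (poly W x / (Y x - poly L x))) x = 0 \<and> ord (poly W x / (Y x - poly L x)) x = Y x"
      if "x \<in> V" for x
    proof -
      have k: "Y x - poly L x \<noteq> 0" and "(Y x)\<^sup>2 = (poly L x)\<^sup>2 + poly K x * poly W x"
        using that Y(3) [of x] by (auto simp: V_def fC_eq)
      moreover define t where "t = poly W x / (Y x - poly L x)"
      then have t: "t * (Y x - poly L x) = poly W x" using k by simp
      ultimately have "(Y x - poly L x) * (ord t x - Y x) = 0"
        unfolding ord_def by algebra
      then have o: "t * poly K x - poly L x = Y x" using k by (simp add: ord_def)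
      have "poly (M t) x = t * (t * poly K x - poly L x) - t * poly L x - poly W x"
        by (simp add: poly_M power2_eq_square algebra_simps)
      then have "poly (M t) x = 0" using t unfolding o by (simp add: algebra_simps)
      with o show ?thesis by (simp add: ord_def t_def)
    qed
    ultimately show thesis
    proof (intro that [of V "\<lambda>x. poly W x / (Y x - poly L x)"])
      have w: "- (2 * s0 * poly L z) = poly W z" using m(1) by (simp add: poly_M True)
      show "poly W z / (Y z - poly L z) = s0" using yz by (simp flip: w add: field_simps)
    qed (use yz z in \<open>auto simp: V_def\<close>)
  qed
qed

text \<open>The parameter is a holomorphic function \<open>\<sigma>\<close> of the abscissa, and the
  moving root is its local inverse. Since \<open>M_s\<close> has \<open>s\<close>-derivative
  \<open>2 (s K - L)\<close>, differentiating \<open>M_{\<sigma>(x)}(x) = 0\<close> gives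
  \<open>M' + 2 Y \<sigma>' = 0\<close>. Simplicity of the root makes \<open>\<sigma>'\<close>
  nonzero, and along the branch \<open>dx / y = - 2 ds / M'\<close>.\<close>

lemma root_branch:
  assumes s0: "s0 \<notin> exceptional" and z: "poly (M s0) z = 0" and "d > 0"
  obtains U Y \<Phi> N \<xi> where "local_branch a U Y \<Phi>" "U \<subseteq> ball z d" "z \<in> U"
    "open N" "s0 \<in> N" "\<xi> s0 = z"
    "\<And>s. s \<in> N \<Longrightarrow> \<xi> s \<in> U \<and> poly (M s) (\<xi> s) = 0 \<and> ord s (\<xi> s) = Y (\<xi> s) \<and>
       (\<xi> has_field_derivative - 2 * Y (\<xi> s) / poly (pderiv (M s)) (\<xi> s)) (at s)"
proof -
  have dz: "poly (pderiv (M s0)) z \<noteq> 0" "fC a z \<noteq> 0"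
    using s0 z unfolding exceptional_def by auto
  then have "ord s0 z \<noteq> 0" using ord_sq [OF z] by auto
  with ord_sq [OF z] obtain r Y \<Phi> where r: "r > 0" and br0: "local_branch a (ball z r) Y \<Phi>" and Yz: "Y z = ord s0 z"
    using local_branch_exists by blast
  have br: "local_branch a U Y \<Phi>" if "open U" "convex U" "U \<subseteq> ball z r" for U
    using br0 that unfolding local_branch_def by (meson holomorphic_on_subset subsetD)
  obtain V \<sigma> where V: "open V" "z \<in> V" "V \<subseteq> ball z r" and hol: "\<sigma> holomorphic_on V" and \<sigma>z: "\<sigma> z = s0"
    and \<sigma>: "\<And>x. x \<in> V \<Longrightarrow> poly (M (\<sigma> x)) x = 0 \<and> ord (\<sigma> x) x = Y x"
    using local_parameter [OF br0 _ z Yz] r by auto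
  have d\<sigma>: "poly (pderiv (M (\<sigma> x))) x + 2 * Y x * deriv \<sigma> x = 0" if x: "x \<in> V" for x
  proof -
    have D: "(\<sigma> has_field_derivative deriv \<sigma> x) (at x)"
      using hol V x holomorphic_derivI by blast
    have "((\<lambda>x. (\<sigma> x)\<^sup>2 * poly K x - 2 * \<sigma> x * poly L x - poly W x) has_field_derivative
        poly (pderiv (M (\<sigma> x))) x + 2 * ord (\<sigma> x) x * deriv \<sigma> x) (at x)"
      by (rule derivative_eq_intros D poly_DERIV refl)+
        (simp add: poly_pderiv_M ord_def algebra_simps power2_eq_square)
    moreover have "((\<lambda>x. (\<sigma> x)\<^sup>2 * poly K x - 2 * \<sigma> x * poly L x - poly W x) has_field_derivative 0) (at x)"
      by (rule has_field_derivative_transform_within_open [OF DERIV_const [of 0] V(1) x])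
        (use \<sigma> in \<open>simp add: poly_M\<close>)
    ultimately have "poly (pderiv (M (\<sigma> x))) x + 2 * ord (\<sigma> x) x * deriv \<sigma> x = 0"
      by (rule DERIV_unique)
    then show ?thesis using \<sigma> [OF x] by (simp only:)
  qed
  have "deriv \<sigma> z \<noteq> 0" using d\<sigma> [OF V(2)] dz \<sigma>z by auto
  then obtain q where q: "q > 0" "ball z q \<subseteq> V \<inter> ball z d" "open (\<sigma> ` ball z q)" "inj_on \<sigma> (ball z q)"
  proof -
    assume nz: "deriv \<sigma> z \<noteq> 0"
    have "\<sigma> holomorphic_on V \<inter> ball z d" using hol by (rule holomorphic_on_subset) auto
    moreover have "z \<in> V \<inter> ball z d" "open (V \<inter> ball z d)" using V \<open>d > 0\<close> by auto
    ultimately show thesis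
      using nz that by (rule has_complex_derivative_locally_invertible)
  qed
  obtain \<xi> where \<xi>: "\<xi> holomorphic_on \<sigma> ` ball z q" "\<And>x. x \<in> ball z q \<Longrightarrow> deriv \<sigma> x * deriv \<xi> (\<sigma> x) = 1"
      "\<And>x. x \<in> ball z q \<Longrightarrow> \<xi> (\<sigma> x) = x"
  proof -
    have "\<sigma> holomorphic_on ball z q" using hol q(2) by (auto intro: holomorphic_on_subset)
    from holomorphic_has_inverse [OF this open_ball q(4)] that show thesis by metis
  qed
  show thesis
  proof (rule that [of "ball z q" Y \<Phi> "\<sigma> ` ball z q" \<xi>])
    show "local_branch a (ball z q) Y \<Phi>" using br q V by auto
    show "\<xi> s0 = z" using \<xi>(3) [of z] q(1) \<sigma>z by simp
    show "s0 \<in> \<sigma> ` ball z q" using q(1) \<sigma>z by (metis centre_in_ball imageI)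
    fix s assume "s \<in> \<sigma> ` ball z q"
    then obtain x where x: "x \<in> ball z q" "s = \<sigma> x" by blast
    then have xV: "x \<in> V" using q by blast
    have "(\<xi> has_field_derivative deriv \<xi> s) (at s)"
      using \<xi>(1) q(3) \<open>s \<in> \<sigma> ` ball z q\<close> holomorphic_derivI by blast
    moreover have "deriv \<xi> s = - 2 * Y x / poly (pderiv (M s)) x"
    proof -
      have "Y x \<noteq> 0" using br0 V xV unfolding local_branch_def by blast
      moreover have n: "deriv \<sigma> x \<noteq> 0" using \<xi>(2) [OF x(1)] by auto
      ultimately have "poly (pderiv (M s)) x \<noteq> 0" "poly (pderiv (M s)) x = - (2 * Y x * deriv \<sigma> x)"
        using d\<sigma> [OF xV] x(2) by (auto simp: eq_neg_iff_add_eq_0)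
      moreover have "deriv \<xi> s = 1 / deriv \<sigma> x"
        using \<xi>(2) [OF x(1)] x(2) n by (simp add: field_simps)
      ultimately show ?thesis using n by (simp add: field_simps)
    qed
    ultimately show "\<xi> s \<in> ball z q \<and> poly (M s) (\<xi> s) = 0 \<and> ord s (\<xi> s) = Y (\<xi> s) \<and>
       (\<xi> has_field_derivative - 2 * Y (\<xi> s) / poly (pderiv (M s)) (\<xi> s)) (at s)"
      using x \<xi>(3) [OF x(1)] \<sigma> [OF xV] by simp
  qed (use q in auto)
qed

end

lemma finite_separated:
  fixes Z :: "complex set"
  assumes "finite Z"
  obtains d where "d > 0" "\<And>z w. z \<in> Z \<Longrightarrow> w \<in> Z \<Longrightarrow> z \<noteq> w \<Longrightarrow> ball z d \<inter> ball w d = {}"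
proof -
  \<comment> \<open>The element \<open>1\<close> keeps the set nonempty, so that \<open>Min\<close>
    is meaningful when \<open>Z\<close> has fewer than two points.\<close>
  define D where "D = insert 1 ((\<lambda>(z, w). dist z w / 2) ` {(z, w) \<in> Z \<times> Z. z \<noteq> w})"
  have fin: "finite D" unfolding D_def using assms
    by (auto intro!: finite_imageI intro: finite_subset [OF _ finite_cartesian_product [OF assms assms]])
  have "Min D > 0" using fin by (subst Min_gr_iff) (auto simp: D_def)
  moreover have "ball z (Min D) \<inter> ball w (Min D) = {}" if "z \<in> Z" "w \<in> Z" "z \<noteq> w" for z w
  proof -
    have "Min D \<le> dist z w / 2" using that fin by (intro Min_le) (auto simp: D_def)
    then show ?thesis by (intro disjoint_ballI) simp
  qed
  ultimately show thesis using that by blast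
qed

section \<open>Abel's theorem along the pencil\<close>

context pencil
begin

text \<open>The vector \<open>u\<close> is fixed while \<open>s\<close> varies, but the paths to the
  four roots are chosen anew for each \<open>s\<close>.\<close>

definition linked :: "complex \<times> complex \<Rightarrow> cvec3 \<Rightarrow> complex \<Rightarrow> bool" where
  "linked P u s \<longleftrightarrow> (\<exists>V. (\<forall>z. poly (M s) z = 0 \<longrightarrow> reach a P z (ord s z) (V z)) \<and>
     u = (\<Sum>z | poly (M s) z = 0. V z))"

text \<open>Near \<open>s0\<close> the four roots move in disjoint discs, and prolonging the four
  paths by the small arcs changes the total by a function of \<open>s\<close> with derivative
  \<open>- 2 \<Sum> x^(k-1) / M'(x) = 0\<close>. The arcs can be run in either direction, which
  gives the equivalence.\<close>

lemma linked_locally_constant: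
  assumes s0: "s0 \<notin> exceptional"
  shows "\<exists>e>0. \<forall>s\<in>ball s0 e. linked P u s \<longleftrightarrow> linked P u s0"
proof -
  define Z where "Z s = {z. poly (M s) z = 0}" for s
  have cardZ: "card (Z s) = 4" "finite (Z s)" if "s \<notin> exceptional" for s
    using card_roots_M [OF that] card.infinite by (fastforce simp: Z_def)+
  obtain d where d: "d > 0" "\<And>z w. z \<in> Z s0 \<Longrightarrow> w \<in> Z s0 \<Longrightarrow> z \<noteq> w \<Longrightarrow> ball z d \<inter> ball w d = {}"
    using finite_separated [OF cardZ(2) [OF s0]] by blast
  define B where "B z U Y \<Phi> N \<xi> \<longleftrightarrow> local_branch a U Y \<Phi> \<and> U \<subseteq> ball z d \<and> z \<in> U \<and> open N \<and> s0 \<in> N \<and> \<xi> s0 = z \<and>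
     (\<forall>s\<in>N. \<xi> s \<in> U \<and> poly (M s) (\<xi> s) = 0 \<and> ord s (\<xi> s) = Y (\<xi> s) \<and>
       (\<xi> has_field_derivative - 2 * Y (\<xi> s) / poly (pderiv (M s)) (\<xi> s)) (at s))" for z U Y \<Phi> N \<xi>
  have "\<exists>U Y \<Phi> N \<xi>. B z U Y \<Phi> N \<xi>" if "z \<in> Z s0" for z
  proof -
    have "poly (M s0) z = 0" using that by (simp add: Z_def)
    from root_branch [OF s0 this d(1)] show ?thesis unfolding B_def by metis
  qed
  then obtain U Y \<Phi> N \<xi> where *: "\<And>z. z \<in> Z s0 \<Longrightarrow> B z (U z) (Y z) (\<Phi> z) (N z) (\<xi> z)"
    by metis
  have br: "local_branch a (U z) (Y z) (\<Phi> z)" and Uz: "U z \<subseteq> ball z d" "z \<in> U z"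
    and Nz: "open (N z)" "s0 \<in> N z" and \<xi>0: "\<xi> z s0 = z"
    and \<xi>: "\<And>s. s \<in> N z \<Longrightarrow> \<xi> z s \<in> U z" "\<And>s. s \<in> N z \<Longrightarrow> poly (M s) (\<xi> z s) = 0"
      "\<And>s. s \<in> N z \<Longrightarrow> ord s (\<xi> z s) = Y z (\<xi> z s)"
      "\<And>s. s \<in> N z \<Longrightarrow> (\<xi> z has_field_derivative - 2 * Y z (\<xi> z s) / poly (pderiv (M s)) (\<xi> z s)) (at s)"
    if "z \<in> Z s0" for z
    using * [OF that] unfolding B_def by auto
  have "open ((\<Inter>z\<in>Z s0. N z) \<inter> - exceptional)"
    using Nz cardZ(2) [OF s0] finite_exceptional by (intro open_Int open_INT) (auto simp: finite_imp_closed open_Compl)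
  moreover have "s0 \<in> (\<Inter>z\<in>Z s0. N z) \<inter> - exceptional" using s0 Nz by auto
  ultimately obtain e where e: "e > 0" "ball s0 e \<subseteq> (\<Inter>z\<in>Z s0. N z) \<inter> - exceptional"
    using open_contains_ball by metis
  have inj: "inj_on (\<lambda>z. \<xi> z s) (Z s0)" if s: "s \<in> ball s0 e" for s
  proof (rule inj_onI, rule ccontr)
    fix z w assume zw: "z \<in> Z s0" "w \<in> Z s0" "\<xi> z s = \<xi> w s" "z \<noteq> w"
    then have "\<xi> z s \<in> ball z d \<inter> ball w d"
      using \<xi>(1) Uz(1) e s by (metis INT_E Int_iff subsetD)
    then show False using d(2) zw by blast
  qed
  \<comment> \<open>Injectivity and counting: four distinct roots of a polynomial with exactly four
    roots are all of them.\<close>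
  have im: "(\<lambda>z. \<xi> z s) ` Z s0 = Z s" if s: "s \<in> ball s0 e" for s
  proof (rule card_subset_eq)
    have se: "s \<notin> exceptional" using e s by auto
    show "finite (Z s)" "card ((\<lambda>z. \<xi> z s) ` Z s0) = card (Z s)"
      using cardZ [OF se] cardZ [OF s0] by (auto simp: card_image [OF inj [OF s]])
    show "(\<lambda>z. \<xi> z s) ` Z s0 \<subseteq> Z s"
      using \<xi>(2) e s unfolding Z_def by auto
  qed
  have const: "(\<Sum>z\<in>Z s0. \<Phi> z (\<xi> z s)) = (\<Sum>z\<in>Z s0. \<Phi> z z)" if s: "s \<in> ball s0 e" for s
  proof (rule coord3_eqI)
    fix k :: nat assume k: "k \<in> {1, 2, 3}"
    let ?g = "\<lambda>s. \<Sum>z\<in>Z s0. coord3 k (\<Phi> z (\<xi> z s))"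
    have "(?g has_field_derivative 0) (at t within ball s0 e)" if t: "t \<in> ball s0 e" for t
    proof -
      have te: "t \<notin> exceptional" using e t by auto
      have "(?g has_field_derivative (\<Sum>z\<in>Z s0. \<xi> z t ^ (k - 1) / Y z (\<xi> z t) *
          (- 2 * Y z (\<xi> z t) / poly (pderiv (M t)) (\<xi> z t)))) (at t)"
      proof (rule DERIV_sum)
        fix z assume z: "z \<in> Z s0"
        then have "t \<in> N z" using e t by auto
        then have "((\<lambda>x. coord3 k (\<Phi> z x)) has_field_derivative \<xi> z t ^ (k - 1) / Y z (\<xi> z t)) (at (\<xi> z t))"
          using br [OF z] \<xi>(1) [OF z] k unfolding local_branch_def by blast
        from DERIV_chain2 [OF this \<xi>(4) [OF z \<open>t \<in> N z\<close>]]
        show "((\<lambda>s. coord3 k (\<Phi> z (\<xi> z s))) has_field_derivative \<xi> z t ^ (k - 1) / Y z (\<xi> z t) *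
          (- 2 * Y z (\<xi> z t) / poly (pderiv (M t)) (\<xi> z t))) (at t)" .
      qed
      \<comment> \<open>The ordinate cancels between \<open>dx / y\<close> and the velocity of the
        root, leaving the sum in Euler's identity.\<close>
      also have "(\<Sum>z\<in>Z s0. \<xi> z t ^ (k - 1) / Y z (\<xi> z t) * (- 2 * Y z (\<xi> z t) / poly (pderiv (M t)) (\<xi> z t)))
          = (\<Sum>z\<in>Z s0. - 2 * (\<xi> z t ^ (k - 1) / poly (pderiv (M t)) (\<xi> z t)))"
      proof (rule sum.cong)
        fix z assume z: "z \<in> Z s0"
        then have "t \<in> N z" using e t by auto
        then have "Y z (\<xi> z t) \<noteq> 0" using br [OF z] \<xi>(1) [OF z] unfolding local_branch_def by blast
        then show "\<xi> z t ^ (k - 1) / Y z (\<xi> z t) * (- 2 * Y z (\<xi> z t) / poly (pderiv (M t)) (\<xi> z t)) =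
            - 2 * (\<xi> z t ^ (k - 1) / poly (pderiv (M t)) (\<xi> z t))" by simp
      qed simp
      also have "\<dots> = - 2 * (\<Sum>w\<in>Z t. w ^ (k - 1) / poly (pderiv (M t)) w)"
        unfolding im [OF t, symmetric] sum.reindex [OF inj [OF t]] by (simp add: sum_distrib_left)
      also have "\<dots> = 0" using sum_roots_M [OF te, of "k - 1"] k unfolding Z_def by auto
      finally show ?thesis by (rule has_field_derivative_at_within)
    qed
    then have "\<exists>c. \<forall>t\<in>ball s0 e. ?g t = c"
      by (intro has_field_derivative_zero_constant convex_ball)
    then obtain c where c: "\<And>t. t \<in> ball s0 e \<Longrightarrow> ?g t = c" by blast
    have "?g s = ?g s0" using c [OF s] c [of s0] e(1) by simp
    then show "coord3 k (\<Sum>z\<in>Z s0. \<Phi> z (\<xi> z s)) = coord3 k (\<Sum>z\<in>Z s0. \<Phi> z z)"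
      using \<xi>0 by (simp add: coord3_sum)
  qed
  have ord0: "ord s0 z = Y z z" if "z \<in> Z s0" for z
    using \<xi>(3) [OF that Nz(2) [OF that]] \<xi>0 [OF that] by simp
  have "linked P u s \<longleftrightarrow> linked P u s0" if s: "s \<in> ball s0 e" for s
  proof
    have sN: "s \<in> N z" if "z \<in> Z s0" for z using e s that by auto
    show "linked P u s0" if lk: "linked P u s"
    proof -
      obtain V where V: "\<And>w. w \<in> Z s \<Longrightarrow> reach a P w (ord s w) (V w)" "u = (\<Sum>w\<in>Z s. V w)"
        using lk unfolding linked_def Z_def by auto
      define V' where "V' z = V (\<xi> z s) + \<Phi> z z - \<Phi> z (\<xi> z s)" for z
      have "reach a P z (ord s0 z) (V' z)" if z: "z \<in> Z s0" for z
      proof -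
        have "\<xi> z s \<in> Z s" using im [OF s] z by blast
        from V(1) [OF this] have "reach a P (\<xi> z s) (Y z (\<xi> z s)) (V (\<xi> z s))"
          using \<xi>(3) [OF z sN [OF z]] by simp
        from reach_extend [OF br [OF z] \<xi>(1) [OF z sN [OF z]] Uz(2) [OF z] this]
        show ?thesis using ord0 [OF z] by (simp add: V'_def)
      qed
      moreover have "(\<Sum>z\<in>Z s0. V' z) = u"
        unfolding V'_def sum_subtractf sum.distrib const [OF s] V(2) im [OF s, symmetric] sum.reindex [OF inj [OF s]]
        by simp
      ultimately show ?thesis unfolding linked_def Z_def by auto
    qed
    show "linked P u s" if lk: "linked P u s0"
    proof -
      obtain V where V: "\<And>w. w \<in> Z s0 \<Longrightarrow> reach a P w (ord s0 w) (V w)" "u = (\<Sum>w\<in>Z s0. V w)"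
        using lk unfolding linked_def Z_def by auto
      define V' where "V' z = V z + \<Phi> z (\<xi> z s) - \<Phi> z z" for z
      \<comment> \<open>The new vectors are indexed by the old roots; \<open>\<zeta>\<close> carries
        the index back from the roots at \<open>s\<close>.\<close>
      define \<zeta> where "\<zeta> = inv_into (Z s0) (\<lambda>z. \<xi> z s)"
      have \<zeta>: "\<zeta> (\<xi> z s) = z" if "z \<in> Z s0" for z
        using inv_into_f_f [OF inj [OF s] that] by (simp add: \<zeta>_def)
      have "reach a P w (ord s w) (V' (\<zeta> w))" if w: "w \<in> Z s" for w
      proof -
        obtain z where z: "z \<in> Z s0" "w = \<xi> z s" using w im [OF s] by blast
        have "reach a P z (Y z z) (V z)" using V(1) [OF z(1)] ord0 [OF z(1)] by simp
        from reach_extend [OF br [OF z(1)] Uz(2) [OF z(1)] \<xi>(1) [OF z(1) sN [OF z(1)]] this]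
        show ?thesis using \<xi>(3) [OF z(1) sN [OF z(1)]] \<zeta> [OF z(1)] z by (simp add: V'_def)
      qed
      moreover have "(\<Sum>w\<in>Z s. V' (\<zeta> w)) = (\<Sum>z\<in>Z s0. V' z)"
        unfolding im [OF s, symmetric] sum.reindex [OF inj [OF s]] using \<zeta> by simp
      moreover have "(\<Sum>z\<in>Z s0. V' z) = u"
        unfolding V'_def sum_subtractf sum.distrib const [OF s] V(2) by simp
      ultimately show ?thesis unfolding linked_def Z_def by (intro exI [of _ "V' \<circ> \<zeta>"]) auto
    qed
  qed
  with e(1) show ?thesis by blast
qed

text \<open>The plane stays connected after removal of the finitely many exceptional parameters, so
  local constancy is enough.\<close>

lemma linked_global:
  assumes "s \<notin> exceptional" "t \<notin> exceptional" "linked P u s"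
  shows "linked P u t"
proof -
  have "connected (UNIV - exceptional)"
    using finite_exceptional by (intro connected_open_delete_finite) auto
  moreover have "\<exists>T. openin (top_of_set (UNIV - exceptional)) T \<and> s \<in> T \<and> (\<forall>x\<in>T. linked P u x = linked P u s)"
    if "s \<in> UNIV - exceptional" for s
  proof -
    obtain e where e: "e > 0" "\<forall>x\<in>ball s e. linked P u x = linked P u s"
      using linked_locally_constant [of s P u] \<open>s \<in> UNIV - exceptional\<close> by blast
    have "openin (top_of_set (UNIV - exceptional)) ((UNIV - exceptional) \<inter> ball s e)"
      by (intro openin_open_Int open_ball)
    moreover have "s \<in> (UNIV - exceptional) \<inter> ball s e" using that e(1) by simp
    ultimately show ?thesis using e(2) by blast
  qed
  ultimately have "linked P u constant_on (UNIV - exceptional)"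
    by (rule locally_constant_imp_constant)
  with assms show ?thesis unfolding constant_on_def by auto
qed

text \<open>Otherwise \<open>f\<close> would be the square \<open>(s K - L)^2\<close>, although its
  roots are simple.\<close>

lemma M_nonzero: "M s \<noteq> 0"
proof
  assume "M s = 0"
  then have "(ord s x)\<^sup>2 = fC a x" for x using ord_sq [of s x] by simp
  then have "poly ((smult s K - L)\<^sup>2) = poly (fpoly a)"
    by (auto simp: poly_fpoly ord_def)
  then have f: "fpoly a = (smult s K - L)\<^sup>2" by (simp add: poly_eq_poly_eq_iff)
  have "card {x. poly (fpoly a) x = 0} = 8"
    using card_roots_rsquarefree(1) [OF rsquarefree_fpoly] degree_fpoly by simp
  then have "{x. poly (fpoly a) x = 0} \<noteq> {}" using card.empty by (metis zero_neq_numeral)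
  then obtain x where x: "poly (fpoly a) x = 0" by blast
  then have "poly (pderiv (fpoly a)) x = 0"
    unfolding f by (simp add: power2_eq_square pderiv_mult)
  with nonsing x show False by (simp add: poly_fpoly poly_pderiv_fpoly)
qed

lemma linked_through_point:
  assumes u: "linked P u 0" and 0: "0 \<notin> exceptional" and br: "local_branch a U Y \<Phi>"
  obtains B where "finite B" "\<And>z. z \<in> U - B \<Longrightarrow> \<exists>s. s \<notin> exceptional \<and> poly (M s) z = 0 \<and> ord s z = Y z \<and> linked P u s"
proof
  \<comment> \<open>Outside the roots of \<open>K\<close> the parameter through
    \<open>(z, Y z)\<close> is \<open>(L + Y) / K\<close>; it is exceptional only over roots of
    finitely many nonzero polynomials \<open>M s\<close>.\<close>
  define B where "B = {x. poly K x = 0} \<union> (\<Union>s\<in>exceptional. {x. poly (M s) x = 0})"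
  have "K \<noteq> 0" using degrees by auto
  then show "finite B"
    unfolding B_def using finite_exceptional M_nonzero poly_roots_finite by blast
  fix z assume z: "z \<in> U - B"
  then have k: "poly K z \<noteq> 0" and y: "(Y z)\<^sup>2 = (poly L z)\<^sup>2 + poly K z * poly W z"
    using br by (auto simp: B_def local_branch_def fC_eq)
  define s where "s = (poly L z + Y z) / poly K z"
  have sk: "s * poly K z = poly L z + Y z" using k by (simp add: s_def)
  with y have "poly K z * poly (M s) z = 0" unfolding poly_M by algebra
  then have "poly (M s) z = 0" using k by simp
  moreover have "ord s z = Y z" using sk by (simp add: ord_def)
  moreover have "s \<notin> exceptional" using z calculation(1) by (auto simp: B_def)
  ultimately show "\<exists>s. s \<notin> exceptional \<and> poly (M s) z = 0 \<and> ord s z = Y z \<and> linked P u s"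
    using linked_global [OF 0 _ u] by blast
qed

end

section \<open>Density of sums of four Abelian integrals\<close>

text \<open>Indexing by a set of abscissae with four elements builds in that the abscissae are
  distinct.\<close>

definition quad_sums :: "(nat \<Rightarrow> complex) \<Rightarrow> complex \<times> complex \<Rightarrow> cvec3 set" where
  "quad_sums a P = {u. \<exists>Z \<eta> V. card Z = 4 \<and> (\<forall>z\<in>Z. reach a P z (\<eta> z) (V z)) \<and> u = (\<Sum>z\<in>Z. V z)}"

lemma poly_pderiv_root_poly_nonzero:
  assumes "finite Z" "z \<in> Z"
  shows "poly (pderiv (root_poly Z)) z \<noteq> 0"
proof -
  have "root_poly Z = [:-z, 1:] * root_poly (Z - {z})"
    using assms by (simp add: root_poly_def prod.remove)
  then have "poly (pderiv (root_poly Z)) z = poly (root_poly (Z - {z})) z"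
    by (simp only: pderiv_mult) (simp add: pderiv_pCons)
  then show ?thesis using assms by (simp add: poly_root_poly)
qed

lemma continuous_closed_cofinite:
  fixes g :: "complex \<Rightarrow> cvec3"
  assumes "continuous_on U g" "open U" "finite F" "closed C" "\<And>z. z \<in> U - F \<Longrightarrow> g z \<in> C" "w \<in> U"
  shows "g w \<in> C"
proof (rule Lim_in_closed_set [OF \<open>closed C\<close>])
  show "(g \<longlongrightarrow> g w) (at w)"
    using assms(1,2,6) by (simp add: continuous_on_eq_continuous_at isCont_def)
  have "open (U - (F - {w}))" "w \<in> U - (F - {w})"
    using assms by (auto intro: open_Diff finite_imp_closed)
  then have "\<forall>\<^sub>F z in at w. z \<in> U - (F - {w})" by (rule eventually_at_in_open')
  moreover have "\<forall>\<^sub>F z in at w. z \<noteq> w" by (simp add: eventually_at_filter)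
  ultimately show "\<forall>\<^sub>F z in at w. g z \<in> C"
    by eventually_elim (use assms(5) in auto)
qed simp

lemma continuous_on_branch: "local_branch a U Y \<Phi> \<Longrightarrow> continuous_on U \<Phi>"
proof -
  assume br: "local_branch a U Y \<Phi>"
  have "continuous_on U (\<lambda>z. coord3 k (\<Phi> z))" if "k \<in> {1,2,3}" for k
    using br that unfolding local_branch_def
    by (meson DERIV_isCont continuous_at_imp_continuous_on)
  from continuous_on_Pair [OF this [of 1] continuous_on_Pair [OF this [of 2] this [of 3]]]
  show ?thesis by (simp add: coord3_def)
qed

text \<open>Two moves: pass to the member of the pencil through \<open>(z, Y z)\<close>, which
  leaves \<open>u\<close> unchanged, then slide that single point from \<open>z\<close> to
  \<open>w\<close>, which adds \<open>\<Phi> w - \<Phi> z\<close>. The first move excludes finitely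
  many \<open>z\<close>, the second finitely many \<open>w\<close>; continuity of
  \<open>\<Phi>\<close> recovers them in the closure.\<close>

lemma quad_sums_translate:
  assumes a8: "a 8 \<noteq> 0" and nonsing: "\<And>x. fC a x = 0 \<Longrightarrow> fC' a x \<noteq> 0"
    and u: "u \<in> quad_sums a P" and br: "local_branch a U Y \<Phi>" and zw: "z0 \<in> U" "w0 \<in> U"
  shows "u + (\<Phi> w0 - \<Phi> z0) \<in> closure (quad_sums a P)"
proof -
  obtain Z \<eta> V where Z: "card Z = 4" and V: "\<And>z. z \<in> Z \<Longrightarrow> reach a P z (\<eta> z) (V z)" and uV: "u = (\<Sum>z\<in>Z. V z)"
    using u unfolding quad_sums_def by blast
  have fin: "finite Z" using Z card.infinite by fastforce
  have \<eta>: "(\<eta> z)\<^sup>2 = fC a z \<and> \<eta> z \<noteq> 0" if "z \<in> Z" for z using reach_point [OF V [OF that]] .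
  \<comment> \<open>The member \<open>s = 0\<close> has ordinates \<open>- L\<close>, so
    \<open>L\<close> must interpolate \<open>- \<eta>\<close> for the given divisor to be that
    member.\<close>
  obtain L K where LK: "fpoly a = L\<^sup>2 + K * root_poly Z" "degree L \<le> 3" "degree K = 4" "coeff K 4 = a 8"
    "\<And>z. z \<in> Z \<Longrightarrow> poly L z = - \<eta> z"
    by (rule interpolation_factorization [of a Z "\<lambda>z. - \<eta> z", OF a8 Z]) (use \<eta> in auto)
  interpret pencil a L K "root_poly Z"
    using a8 nonsing LK Z lead_coeff_root_poly [of Z] by unfold_locales auto
  have M0: "poly (M 0) z = 0 \<longleftrightarrow> z \<in> Z" for z
    using poly_root_poly [OF fin] by (simp add: poly_M)
  have "fC a z \<noteq> 0" if "z \<in> Z" for z using \<eta> [OF that] by auto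
  then have 0: "0 \<notin> exceptional"
    using M0 poly_pderiv_root_poly_nonzero [OF fin] unfolding exceptional_def
    by (auto simp: poly_pderiv_M)
  have lk: "linked P u 0"
    unfolding linked_def M0 using V LK(5) uV by (intro exI [of _ V]) (auto simp: ord_def)
  obtain B where B: "finite B"
    "\<And>z. z \<in> U - B \<Longrightarrow> \<exists>s. s \<notin> exceptional \<and> poly (M s) z = 0 \<and> ord s z = Y z \<and> linked P u s"
    using linked_through_point [OF lk 0 br] by blast
  have U: "open U" and c\<Phi>: "continuous_on U \<Phi>"
    using br continuous_on_branch unfolding local_branch_def by auto
  have step: "u + (\<Phi> w0 - \<Phi> z) \<in> closure (quad_sums a P)" if z: "z \<in> U - B" for z
  proof -
    obtain s where s: "s \<notin> exceptional" "poly (M s) z = 0" "ord s z = Y z" "linked P u s"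
      using B(2) [OF z] by blast
    define Z' where "Z' = {z. poly (M s) z = 0}"
    obtain V' where V': "\<And>z. z \<in> Z' \<Longrightarrow> reach a P z (ord s z) (V' z)" "u = (\<Sum>z\<in>Z'. V' z)"
      using s(4) unfolding linked_def Z'_def by auto
    have Z': "card Z' = 4" "z \<in> Z'" "finite Z'"
      using card_roots_M [OF s(1)] s(2) card.infinite by (fastforce simp: Z'_def)+
    \<comment> \<open>The sliding point must not meet the other three abscissae; its own starting
      place \<open>z\<close> is allowed.\<close>
    have "u + (\<Phi> w - \<Phi> z) \<in> quad_sums a P" if w: "w \<in> U - (Z' - {z})" for w
    proof -
      define V'' where "V'' = V' (w := V' z + \<Phi> w - \<Phi> z)"
      define \<eta>' where "\<eta>' = (ord s) (w := Y w)"
      have wn: "w \<notin> Z' - {z}" using w by blast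
      have "reach a P x (\<eta>' x) (V'' x)" if "x \<in> insert w (Z' - {z})" for x
      proof (cases "x = w")
        case True
        have "reach a P z (Y z) (V' z)" using V'(1) [OF Z'(2)] s(3) by simp
        from reach_extend [OF br _ _ this, of w] True z w show ?thesis by (simp add: \<eta>'_def V''_def)
      next
        case False
        with that V'(1) show ?thesis by (auto simp: \<eta>'_def V''_def)
      qed
      moreover have "card (insert w (Z' - {z})) = 4" using wn Z' by simp
      moreover have "(\<Sum>x\<in>insert w (Z' - {z}). V'' x) = u + (\<Phi> w - \<Phi> z)"
      proof -
        have "(\<Sum>x\<in>insert w (Z' - {z}). V'' x) = V'' w + (\<Sum>x\<in>Z' - {z}. V'' x)"
          using wn Z'(3) by (intro sum.insert) auto
        also have "(\<Sum>x\<in>Z' - {z}. V'' x) = (\<Sum>x\<in>Z' - {z}. V' x)"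
          using wn by (intro sum.cong) (auto simp: V''_def)
        also have "\<dots> = u - V' z" using V'(2) Z' by (simp add: sum_diff1)
        finally show ?thesis by (simp add: V''_def algebra_simps)
      qed
      ultimately show ?thesis unfolding quad_sums_def
        by (intro CollectI exI [of _ "insert w (Z' - {z})"] exI [of _ \<eta>'] exI [of _ V'']) auto
    qed
    then have cl: "\<And>w. w \<in> U - (Z' - {z}) \<Longrightarrow> u + (\<Phi> w - \<Phi> z) \<in> closure (quad_sums a P)"
      using closure_subset by blast
    have "continuous_on U (\<lambda>w. u + (\<Phi> w - \<Phi> z))" using c\<Phi> by (intro continuous_intros)
    from continuous_closed_cofinite [OF this U _ closed_closure cl zw(2)] Z'(3)
    show ?thesis by blast
  qed
  have "continuous_on U (\<lambda>z. u + (\<Phi> w0 - \<Phi> z))" using c\<Phi> by (intro continuous_intros)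
  from continuous_closed_cofinite [OF this U B(1) closed_closure step zw(1)] show ?thesis .
qed

lemma vandermonde3_solve:
  fixes x1 x2 x3 p q r :: complex
  assumes "x1 \<noteq> x2" "x1 \<noteq> x3" "x2 \<noteq> x3"
  obtains c1 c2 c3 where "c1 + c2 + c3 = p" "c1 * x1 + c2 * x2 + c3 * x3 = q"
    "c1 * x1\<^sup>2 + c2 * x2\<^sup>2 + c3 * x3\<^sup>2 = r"
proof -
  \<comment> \<open>The combination of the equations with the coefficients of
    \<open>(X - x1) (X - x2)\<close> eliminates \<open>c1\<close> and \<open>c2\<close>.\<close>
  define c3 where "c3 = (r - (x1 + x2) * q + x1 * x2 * p) / ((x3 - x1) * (x3 - x2))"
  define c2 where "c2 = (q - x1 * p - c3 * (x3 - x1)) / (x2 - x1)"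
  define c1 where "c1 = p - c2 - c3"
  have 3: "c3 * ((x3 - x1) * (x3 - x2)) = r - (x1 + x2) * q + x1 * x2 * p"
    and 2: "c2 * (x2 - x1) = q - x1 * p - c3 * (x3 - x1)"
    using assms by (simp_all add: c3_def c2_def)
  show thesis
  proof (rule that)
    show 1: "c1 + c2 + c3 = p" by (simp add: c1_def)
    have "c1 * x1 + c2 * x2 + c3 * x3 = p * x1 + c2 * (x2 - x1) + c3 * (x3 - x1)"
      by (simp add: c1_def algebra_simps)
    then show "c1 * x1 + c2 * x2 + c3 * x3 = q" unfolding 2 by simp
    have "c1 * x1\<^sup>2 + c2 * x2\<^sup>2 + c3 * x3\<^sup>2 =
        p * x1\<^sup>2 + c2 * (x2 - x1) * (x2 + x1) + c3 * (x3 - x1) * (x3 + x1)"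
      by (simp add: c1_def power2_eq_square algebra_simps)
    also have "\<dots> = p * x1\<^sup>2 + (q - x1 * p) * (x1 + x2) + c3 * ((x3 - x1) * (x3 - x2))"
      unfolding 2 by (simp add: algebra_simps)
    also have "\<dots> = r" unfolding 3 by (simp add: power2_eq_square algebra_simps)
    finally show "c1 * x1\<^sup>2 + c2 * x2\<^sup>2 + c3 * x3\<^sup>2 = r" .
  qed
qed

lemma LIMSEQ_scaled_difference:
  fixes f :: "complex \<Rightarrow> complex"
  assumes "(f has_field_derivative D) (at x)"
  shows "(\<lambda>n. of_nat n * (f (x + h / of_nat n) - f x)) \<longlonglongrightarrow> h * D"
proof -
  have "((\<lambda>t. f (x + h * t)) has_field_derivative D * h) (at 0)"
    using assms by (auto intro!: derivative_eq_intros DERIV_chain2 [of f])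
  then have "((\<lambda>t. (f (x + h * t) - f x) / t) \<longlongrightarrow> D * h) (at 0)"
    by (simp add: has_field_derivative_iff)
  moreover have "filterlim (\<lambda>n. inverse (of_nat n) :: complex) (at 0) sequentially"
    by (auto simp: filterlim_at intro: lim_inverse_n eventually_sequentiallyI [of 1])
  ultimately have "(\<lambda>n. (f (x + h * inverse (of_nat n)) - f x) / inverse (of_nat n)) \<longlonglongrightarrow> D * h"
    by (rule filterlim_compose)
  then show ?thesis by (simp add: field_simps)
qed

text \<open>The translations preserving the closure \<open>X\<close> form a closed additive
  semigroup \<open>G\<close>. It contains the increments of \<open>\<Phi>\<close> along small arcs;
  \<open>n\<close> times an increment of size \<open>1 / n\<close> tends to a tangent vector, so
  \<open>G\<close> contains the complex line through \<open>(1, x, x^2)\<close> for almost every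
  \<open>x\<close>, and three such lines span. The factor \<open>c\<close> being an arbitrary
  complex number, no inverses in \<open>G\<close> are required.\<close>

theorem closure_quad_sums:
  assumes a8: "a 8 \<noteq> 0" and nonsing: "\<And>x. fC a x = 0 \<Longrightarrow> fC' a x \<noteq> 0"
    and base: "y0\<^sup>2 = fC a x0" "y0 \<noteq> 0"
  shows "closure (quad_sums a (x0, y0)) = UNIV"
proof -
  define X where "X = closure (quad_sums a (x0, y0))"
  define G where "G = {v. \<forall>u\<in>X. u + v \<in> X}"
  have clX: "closed X" by (simp add: X_def)
  have G_add: "v + w \<in> G" if "v \<in> G" "w \<in> G" for v w
    using that unfolding G_def by (auto simp flip: add.assoc)
  have G_mult: "of_nat n *\<^sub>R v \<in> G" if "v \<in> G" for n v
    by (induction n) (use G_add [OF that] in \<open>auto simp: G_def scaleR_left_distrib\<close>)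
  have eqG: "G = (\<Inter>u\<in>X. (\<lambda>v. u + v) -` X)" by (auto simp: G_def)
  have clG: "closed G"
    unfolding eqG by (intro closed_INT ballI closed_vimage clX continuous_intros)
  have branch_G: "\<Phi> w - \<Phi> z \<in> G" if "local_branch a U Y \<Phi>" "z \<in> U" "w \<in> U" for U Y \<Phi> z w
  proof -
    have "closed ((\<lambda>u. u + (\<Phi> w - \<Phi> z)) -` X)"
      using clX by (intro closed_vimage continuous_intros)
    \<comment> \<open>Translation was established only for genuine sums, with values in the closure;
      the preimage of \<open>X\<close> being closed, it extends to all of \<open>X\<close>.\<close>
    moreover have "quad_sums a (x0, y0) \<subseteq> (\<lambda>u. u + (\<Phi> w - \<Phi> z)) -` X"
      using quad_sums_translate [OF a8 nonsing _ that] by (auto simp: X_def)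
    ultimately have "X \<subseteq> (\<lambda>u. u + (\<Phi> w - \<Phi> z)) -` X"
      unfolding X_def by (intro closure_minimal)
    then show ?thesis unfolding G_def by blast
  qed
  have line_G: "(c, c * x, c * x\<^sup>2) \<in> G" if "fC a x \<noteq> 0" for c x
  proof -
    define y where "y = csqrt (fC a x)"
    have y: "y\<^sup>2 = fC a x" "y \<noteq> 0" using that by (auto simp: y_def)
    obtain r Y \<Phi> where r: "r > 0" and br: "local_branch a (ball x r) Y \<Phi>" and Yx: "Y x = y"
      using local_branch_exists [OF y] by blast
    \<comment> \<open>The factor \<open>y\<close> cancels the denominator of \<open>dx / y\<close>
      in the limit.\<close>
    define w where "w n = x + c * y / of_nat n" for n :: nat
    have "(\<lambda>n. c * y / of_nat n) \<longlonglongrightarrow> 0" by (rule lim_const_over_n)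
    then have "w \<longlonglongrightarrow> x + 0" unfolding w_def [abs_def] by (intro tendsto_intros)
    then have "\<forall>\<^sub>F n in sequentially. w n \<in> ball x r"
      using r by (intro topological_tendstoD) auto
    then have ev: "\<forall>\<^sub>F n in sequentially. of_nat n *\<^sub>R (\<Phi> (w n) - \<Phi> x) \<in> G"
      by eventually_elim (use branch_G [OF br] r G_mult in auto)
    have lim: "(\<lambda>n. of_nat n * (coord3 k (\<Phi> (w n)) - coord3 k (\<Phi> x))) \<longlonglongrightarrow> c * x ^ (k - 1)" if "k \<in> {1,2,3}" for k
    proof -
      have "((\<lambda>z. coord3 k (\<Phi> z)) has_field_derivative x ^ (k - 1) / y) (at x)"
        using br that r Yx unfolding local_branch_def by (metis centre_in_ball)
      from LIMSEQ_scaled_difference [OF this, of "c * y"] show ?thesis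
        using y by (simp add: w_def)
    qed
    have "(\<lambda>n. of_nat n *\<^sub>R (\<Phi> (w n) - \<Phi> x)) \<longlonglongrightarrow> (c, c * x, c * x\<^sup>2)"
      using tendsto_Pair [OF lim [of 1] tendsto_Pair [OF lim [of 2] lim [of 3]]]
      by (simp add: coord3_def scaleR_prod_def scaleR_conv_of_real)
    then show ?thesis
      using Lim_in_closed_set [OF clG ev] by simp
  qed
  have "fpoly a \<noteq> 0" using coeff_fpoly [of a 8] a8 by auto
  then have "finite {x. fC a x = 0}" using poly_roots_finite by (fastforce simp: poly_fpoly)
  then have "infinite (- {x. fC a x = 0})" by (simp add: finite_compl infinite_UNIV_char_0)
  then obtain S where S: "card S = 3" "S \<subseteq> - {x. fC a x = 0}"
    using infinite_arbitrarily_large by metis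
  then obtain x1 x2 x3 where x: "x1 \<noteq> x2" "x1 \<noteq> x3" "x2 \<noteq> x3" "fC a x1 \<noteq> 0" "fC a x2 \<noteq> 0" "fC a x3 \<noteq> 0"
    by (auto simp: card_3_iff)
  have G: "v \<in> G" for v
  proof -
    obtain p q r where v: "v = (p, q, r)" by (cases v)
    obtain c1 c2 c3 where "c1 + c2 + c3 = p" "c1 * x1 + c2 * x2 + c3 * x3 = q"
        "c1 * x1\<^sup>2 + c2 * x2\<^sup>2 + c3 * x3\<^sup>2 = r"
      using vandermonde3_solve [OF x(1-3)] by blast
    then have eq: "v = (c1, c1 * x1, c1 * x1\<^sup>2) + (c2, c2 * x2, c2 * x2\<^sup>2) + (c3, c3 * x3, c3 * x3\<^sup>2)"
      by (simp add: v)
    show ?thesis unfolding eq by (intro G_add line_G x)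
  qed
  obtain r Y \<Phi> where r: "r > 0" and br: "local_branch a (ball x0 r) Y \<Phi>" and Y0: "Y x0 = y0"
    using local_branch_exists [OF base] by blast
  \<comment> \<open>Nonemptiness of \<open>X\<close>: four distinct points close to the base
    point.\<close>
  have "infinite (ball x0 r)" using r uncountable_ball uncountable_infinite by blast
  then obtain Z where Z: "card Z = 4" "Z \<subseteq> ball x0 r"
    using infinite_arbitrarily_large by metis
  have "reach a (x0, y0) x0 (Y x0) 0" using reach_refl base Y0 by simp
  from reach_extend [OF br _ _ this] r Z(2)
  have "\<forall>z\<in>Z. reach a (x0, y0) z (Y z) (0 + \<Phi> z - \<Phi> x0)" by auto
  then have "(\<Sum>z\<in>Z. 0 + \<Phi> z - \<Phi> x0) \<in> quad_sums a (x0, y0)"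
    unfolding quad_sums_def using Z(1)
    by (intro CollectI exI [of _ Z] exI [of _ Y] exI [of _ "\<lambda>z. 0 + \<Phi> z - \<Phi> x0"]) auto
  then obtain u where "u \<in> X" unfolding X_def using closure_subset by blast
  then have "u + (v - u) \<in> X" for v using G [of "v - u"] unfolding G_def by blast
  then show ?thesis unfolding X_def by auto
qed

section \<open>The algebra of \<open>h\<close> and \<open>A\<close>\<close>

lemma sum_lessThan_5: "(\<Sum>i<(5::nat). f i) = f 0 + f 1 + f 2 + f 3 + (f 4 :: complex)"
  by (simp add: eval_nat_numeral)

text \<open>\<open>h(x, y)\<close> depends on the \<open>\<wp>\<^sub>i\<^sub>j\<close> through \<open>- 2 (x - y)\<^sup>2 bil \<wp> x y\<close>; only indices \<open>i \<le> j\<close> occur.\<close>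
definition bil :: "(nat \<Rightarrow> nat \<Rightarrow> complex) \<Rightarrow> complex \<Rightarrow> complex \<Rightarrow> complex" where
  "bil p x y = p 1 1 + p 1 2 * (x + y) + p 1 3 * (x\<^sup>2 + y\<^sup>2) + p 2 2 * (x * y)
     + p 2 3 * (x * y * (x + y)) + p 3 3 * (x\<^sup>2 * y\<^sup>2)"

lemma bil_diff: "bil (\<lambda>i j. p i j - p' i j) x y = bil p x y - bil p' x y"
  by (simp add: bil_def algebra_simps)

lemma hform_diff:
  "hform (hmat a p) x y - hform (hmat a p') x y = - 2 * (x - y)\<^sup>2 * (bil p x y - bil p' x y)"
  unfolding hform_def sum_lessThan_5 hmat_def bil_def
  by simp algebra

lemma quadratic_three_roots:
  fixes c0 c1 c2 :: complex
  assumes "3 \<le> card S" "\<And>x. x \<in> S \<Longrightarrow> c0 + c1 * x + c2 * x\<^sup>2 = 0"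
  shows "c0 = 0 \<and> c1 = 0 \<and> c2 = 0"
proof (rule ccontr)
  assume "\<not> ?thesis"
  then have nz: "[:c0, c1, c2:] \<noteq> 0" by auto
  have "S \<subseteq> {x. poly [:c0, c1, c2:] x = 0}"
    using assms(2) by (auto simp: power2_eq_square algebra_simps)
  then have "card S \<le> degree [:c0, c1, c2:]"
    using card_mono [OF poly_roots_finite [OF nz]] card_poly_roots_bound [OF nz] by (meson order_trans)
  moreover have "degree [:c0, c1, c2:] \<le> 2" by (simp add: degree_pCons_eq_if)
  ultimately show False using assms(1) by linarith
qed

text \<open>For fixed \<open>z\<close> the form is quadratic in \<open>w\<close> with three zeros,
  so its coefficients vanish; each of them is quadratic in \<open>z\<close> and vanishes at four
  points.\<close>

lemma bil_eq_zero:
  assumes Z: "card Z = 4" and 0: "\<And>z w. z \<in> Z \<Longrightarrow> w \<in> Z \<Longrightarrow> z \<noteq> w \<Longrightarrow> bil q z w = 0"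
  shows "q 1 1 = 0 \<and> q 1 2 = 0 \<and> q 1 3 = 0 \<and> q 2 2 = 0 \<and> q 2 3 = 0 \<and> q 3 3 = 0"
proof -
  have "q 1 1 + q 1 2 * z + q 1 3 * z\<^sup>2 = 0 \<and> q 1 2 + q 2 2 * z + q 2 3 * z\<^sup>2 = 0 \<and> q 1 3 + q 2 3 * z + q 3 3 * z\<^sup>2 = 0"
    if z: "z \<in> Z" for z
  proof (rule quadratic_three_roots)
    show "3 \<le> card (Z - {z})" using Z z by simp
    show "q 1 1 + q 1 2 * z + q 1 3 * z\<^sup>2 + (q 1 2 + q 2 2 * z + q 2 3 * z\<^sup>2) * w + (q 1 3 + q 2 3 * z + q 3 3 * z\<^sup>2) * w\<^sup>2 = 0"
      if "w \<in> Z - {z}" for w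
    proof -
      have "bil q z w = 0" using 0 [of z w] that z by blast
      then show ?thesis by (simp add: bil_def algebra_simps power2_eq_square)
    qed
  qed
  then show ?thesis
    using quadratic_three_roots [of Z "q 1 1" "q 1 2" "q 1 3"] quadratic_three_roots [of Z "q 1 2" "q 2 2" "q 2 3"]
      quadratic_three_roots [of Z "q 1 3" "q 2 3" "q 3 3"] Z by simp
qed

lemma poly_degree_4:
  fixes p :: "complex poly"
  assumes "degree p \<le> 4"
  shows "p = [:coeff p 0, coeff p 1, coeff p 2, coeff p 3, coeff p 4:]"
proof (rule poly_eqI)
  fix n
  show "coeff p n = coeff [:coeff p 0, coeff p 1, coeff p 2, coeff p 3, coeff p 4:] n"
    using assms coeff_eq_0 [of p n]
    by (cases "n \<le> 4") (auto simp: coeff_pCons eval_nat_numeral le_Suc_eq split: nat.split)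
qed

lemma fpoly_explicit:
  "fpoly a = [:a 0, 8 * a 1, 28 * a 2, 56 * a 3, 70 * a 4, 56 * a 5, 28 * a 6, 8 * a 7, a 8:]"
  by (simp add: fpoly_def eval_nat_numeral monom_Suc monom_0)

text \<open>The determinant of columns \<open>i, j, k\<close> of the coefficient matrix with rows
  \<open>L, K, W\<close>; the factor \<open>- 1 / 4\<close> is the constant produced by
  differentiating the relations.\<close>

definition minor :: "complex poly \<Rightarrow> complex poly \<Rightarrow> complex poly \<Rightarrow> nat \<Rightarrow> nat \<Rightarrow> nat \<Rightarrow> complex" where
  "minor L K W i j k = - (1 / 4) * (coeff L i * (coeff K j * coeff W k - coeff K k * coeff W j)
     - coeff K i * (coeff L j * coeff W k - coeff L k * coeff W j)
     + coeff W i * (coeff L j * coeff K k - coeff L k * coeff K j))"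

text \<open>The polarization of \<open>L^2 + K W\<close>: on the diagonal \<open>x = y\<close> the
  associated form is \<open>f\<close>.\<close>

definition rank3 :: "complex poly \<Rightarrow> complex poly \<Rightarrow> complex poly \<Rightarrow> nat \<Rightarrow> nat \<Rightarrow> complex" where
  "rank3 L K W i j = coeff L i * coeff L j + (coeff K i * coeff W j + coeff W i * coeff K j) / 2"

lemma hform_rank3:
  assumes "degree L \<le> 4" "degree K \<le> 4" "degree W \<le> 4"
  shows "hform (rank3 L K W) x y = poly L x * poly L y + (poly K x * poly W y + poly W x * poly K y) / 2"
proof -
  have p: "poly p x = coeff p 0 + coeff p 1 * x + coeff p 2 * x^2 + coeff p 3 * x^3 + coeff p 4 * x^4"
    if "degree p \<le> 4" for p :: "complex poly" and x
    by (subst poly_degree_4 [OF that]) (simp add: algebra_simps eval_nat_numeral)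
  show ?thesis
    unfolding hform_def sum_lessThan_5 rank3_def p [OF assms(1)] p [OF assms(2)] p [OF assms(3)]
    by (simp add: algebra_simps add_divide_distrib)
qed

text \<open>The matrices \<open>hmat a p\<close> are exactly the symmetric ones whose antidiagonal
  sums are the coefficients of \<open>f\<close>, and \<open>rank3 L K W\<close> is one of them, for
  parameters \<open>p'\<close>. At two roots of \<open>W\<close> both forms equal
  \<open>L(z) L(w)\<close>, so \<open>p - p'\<close> is annihilated at all six pairs.\<close>

lemma hmat_eq_rank3:
  assumes f: "fpoly a = L\<^sup>2 + K * W" and deg: "degree L \<le> 4" "degree K \<le> 4" "degree W \<le> 4"
    and Z: "card Z = 4" "\<And>z. z \<in> Z \<Longrightarrow> poly W z = 0"
    and h: "\<And>z w. z \<in> Z \<Longrightarrow> w \<in> Z \<Longrightarrow> z \<noteq> w \<Longrightarrow> hform (hmat a p) z w = poly L z * poly L w"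
    and "i < 5" "j < 5"
  shows "hmat a p i j = rank3 L K W i j"
proof -
  define H where "H = rank3 L K W"
  \<comment> \<open>Solved from the entries \<open>(0,2)\<close>, \<open>(0,3)\<close>,
    \<open>(0,4)\<close>, \<open>(1,3)\<close>, \<open>(1,4)\<close>, \<open>(2,4)\<close>; the
    others then follow from \<open>eqs\<close>. Only \<open>i \<le> j\<close> is meaningful.\<close>
  define p' :: "nat \<Rightarrow> nat \<Rightarrow> complex" where
    "p' i j = (if i = 1 then (if j = 1 then (6 * a 2 - H 0 2) / 2 else if j = 2 then (4 * a 3 - H 0 3) / 2
        else (a 4 - H 0 4) / 2)
      else if i = 2 then (if j = 2 then (16 * a 4 + 2 * (a 4 - H 0 4) - H 1 3) / 2 else (4 * a 5 - H 1 4) / 2)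
      else (6 * a 6 - H 2 4) / 2)" for i j
  obtain l0 l1 l2 l3 l4 where L: "L = [:l0, l1, l2, l3, l4:]" using poly_degree_4 [OF deg(1)] by blast
  obtain k0 k1 k2 k3 k4 where K: "K = [:k0, k1, k2, k3, k4:]" using poly_degree_4 [OF deg(2)] by blast
  obtain w0 w1 w2 w3 w4 where W: "W = [:w0, w1, w2, w3, w4:]" using poly_degree_4 [OF deg(3)] by blast
  have c: "coeff [:c0, c1, c2, c3, c4:] 0 = c0" "coeff [:c0, c1, c2, c3, c4:] 1 = c1"
    "coeff [:c0, c1, c2, c3, c4:] 2 = c2" "coeff [:c0, c1, c2, c3, c4:] 3 = c3"
    "coeff [:c0, c1, c2, c3, c4:] 4 = c4" for c0 c1 c2 c3 c4 :: complex
    by (simp_all add: eval_nat_numeral)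
  have sym: "H i j = H j i" for i j by (simp add: H_def rank3_def algebra_simps)
  \<comment> \<open>The nine antidiagonal sums, by comparing coefficients in
    \<open>f = L^2 + K W\<close>.\<close>
  have eqs: "a 0 = H 0 0" "8 * a 1 = 2 * H 0 1" "28 * a 2 = 2 * H 0 2 + H 1 1" "56 * a 3 = 2 * H 0 3 + 2 * H 1 2"
    "70 * a 4 = 2 * H 0 4 + 2 * H 1 3 + H 2 2" "56 * a 5 = 2 * H 1 4 + 2 * H 2 3" "28 * a 6 = 2 * H 2 4 + H 3 3"
    "8 * a 7 = 2 * H 3 4" "a 8 = H 4 4"
    using f unfolding fpoly_explicit H_def rank3_def L K W c
    by (simp_all add: power2_eq_square algebra_simps add_divide_distrib)
  have i5: "m = 0 \<or> m = 1 \<or> m = 2 \<or> m = 3 \<or> m = 4" if "m < 5" for m :: nat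
    using that by linarith
  have "2 * H 1 2 = 2 * (28 * a 3 - H 0 3)" "2 * H 2 3 = 2 * (28 * a 5 - H 1 4)"
    using eqs(4,6) by (simp_all add: algebra_simps)
  then have e': "H 1 2 = 28 * a 3 - H 0 3" "H 2 3 = 28 * a 5 - H 1 4"
    by (simp_all only: mult_cancel_left, simp_all)
  have e: "H 1 1 = 28 * a 2 - 2 * H 0 2" "H 1 2 = 28 * a 3 - H 0 3" "H 2 2 = 70 * a 4 - 2 * H 0 4 - 2 * H 1 3"
    "H 2 3 = 28 * a 5 - H 1 4" "H 3 3 = 28 * a 6 - 2 * H 2 4" "4 * a 1 = H 0 1" "4 * a 7 = H 3 4"
    using eqs e' by simp_all
  have entries: "a 0 = H 0 0" "6 * a 2 - 2 * p' 1 1 = H 0 2" "4 * a 3 - 2 * p' 1 2 = H 0 3"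
    "a 4 - 2 * p' 1 3 = H 0 4" "16 * a 2 + 4 * p' 1 1 = H 1 1" "24 * a 3 + 2 * p' 1 2 = H 1 2"
    "16 * a 4 - 2 * p' 2 2 + 4 * p' 1 3 = H 1 3" "4 * a 5 - 2 * p' 2 3 = H 1 4"
    "36 * a 4 + 4 * p' 2 2 - 4 * p' 1 3 = H 2 2" "24 * a 5 + 2 * p' 2 3 = H 2 3" "6 * a 6 - 2 * p' 3 3 = H 2 4"
    "16 * a 6 + 4 * p' 3 3 = H 3 3" "a 8 = H 4 4"
    unfolding e(1-5) by (simp_all add: p'_def eqs(1,9) field_simps)
  have p': "hmat a p' m n = H m n" if "m < 5" "n < 5" for m n
    using i5 [OF that(1)] i5 [OF that(2)] unfolding hmat_def entries e(6,7)
    by (elim disjE; simp; simp add: sym)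
  have "hform (hmat a p') x y = hform H x y" for x y
    unfolding hform_def using p' by (intro sum.cong) auto
  then have "hform (hmat a p') z w = poly L z * poly L w" if "z \<in> Z" "w \<in> Z" for z w
    using hform_rank3 [OF deg] Z(2) that by (simp add: H_def)
  then have b: "bil (\<lambda>i j. p i j - p' i j) z w = 0" if "z \<in> Z" "w \<in> Z" "z \<noteq> w" for z w
    using hform_diff [of a p z w p'] h that by (simp add: bil_diff)
  from bil_eq_zero [OF Z(1) b]
  have "p 1 1 = p' 1 1" "p 1 2 = p' 1 2" "p 1 3 = p' 1 3" "p 2 2 = p' 2 2" "p 2 3 = p' 2 3" "p 3 3 = p' 3 3"
    by simp_all
  then have "hmat a p i j = hmat a p' i j"
    unfolding hmat_def by simp
  with p' [OF \<open>i < 5\<close> \<open>j < 5\<close>] show ?thesis by (simp add: H_def)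
qed

text \<open>The symmetric tensor \<open>T\<close> with \<open>T(x, y, z) (y - x) (z - x) (z - y) = - det / 4\<close>, where \<open>det\<close> has rows
  \<open>(L, K, W)\<close> at \<open>x, y, z\<close>: the quotients of the monomial determinants by the Vandermonde determinant are
  Schur functions, whose coefficients are the ones below. It is given for \<open>i \<le> j\<close> only.\<close>
definition third :: "complex poly \<Rightarrow> complex poly \<Rightarrow> complex poly \<Rightarrow> nat \<Rightarrow> nat \<Rightarrow> nat \<Rightarrow> complex" where
  "third L K W i j k = (let n = minor L K W in
     (if i = 1 then (if j = 1 then [n 0 1 2, n 0 1 3, n 0 1 4]
        else if j = 2 then [n 0 1 3, n 0 1 4 + n 0 2 3, n 0 2 4] else [n 0 1 4, n 0 2 4, n 0 3 4])
      else if i = 2 then (if j = 2 then [n 0 1 4 + n 0 2 3, 2 * n 0 2 4 + n 1 2 3, n 0 3 4 + n 1 2 4]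
        else [n 0 2 4, n 0 3 4 + n 1 2 4, n 1 3 4])
      else [n 0 3 4, n 1 3 4, n 2 3 4]) ! (k - 1))"

text \<open>When the point over \<open>x\<close> moves, the integrals change at the rate
  \<open>(1, x, x^2) / y\<close>; this is \<open>y\<close> times the resulting derivative of
  \<open>\<wp>\<^sub>i\<^sub>j\<close>.\<close>

definition contract :: "(nat \<Rightarrow> nat \<Rightarrow> nat \<Rightarrow> complex) \<Rightarrow> complex \<Rightarrow> nat \<Rightarrow> nat \<Rightarrow> complex" where
  "contract q x i j = q i j 1 + q i j 2 * x + q i j 3 * x\<^sup>2"

definition det3 :: "complex \<times> complex \<times> complex \<Rightarrow> complex \<times> complex \<times> complex \<Rightarrow> complex \<times> complex \<times> complex \<Rightarrow> complex" where
  "det3 u v w = (case (u, v, w) of ((a, b, c), (a', b', c'), (a'', b'', c'')) \<Rightarrow>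
     a * (b' * c'' - c' * b'') - b * (a' * c'' - c' * a'') + c * (a' * b'' - b' * a''))"

definition row :: "complex poly \<Rightarrow> complex poly \<Rightarrow> complex poly \<Rightarrow> complex \<Rightarrow> complex \<times> complex \<times> complex" where
  "row L K W x = (poly L x, poly K x, poly W x)"

text \<open>The second identity is the confluent form of the first: divide by \<open>z - y\<close>
  and let \<open>y\<close> tend to \<open>z\<close>, which turns a difference of rows into the
  derivative row. It serves the pairs containing the moving point.\<close>

lemma bil_third:
  assumes deg: "degree L \<le> 4" "degree K \<le> 4" "degree W \<le> 4"
  shows "(y - x) * (z - x) * (z - y) * bil (contract (third L K W) z) x y =
      - det3 (row L K W x) (row L K W y) (row L K W z) / 4"
    and "(z - x)\<^sup>2 * bil (contract (third L K W) z) x z =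
      - det3 (row L K W x) (row L K W z) (row (pderiv L) (pderiv K) (pderiv W) z) / 4"
proof -
  obtain l0 l1 l2 l3 l4 where L: "L = [:l0, l1, l2, l3, l4:]" using poly_degree_4 [OF deg(1)] by blast
  obtain k0 k1 k2 k3 k4 where K: "K = [:k0, k1, k2, k3, k4:]" using poly_degree_4 [OF deg(2)] by blast
  obtain w0 w1 w2 w3 w4 where W: "W = [:w0, w1, w2, w3, w4:]" using poly_degree_4 [OF deg(3)] by blast
  have c: "coeff [:c0, c1, c2, c3, c4:] 0 = c0" "coeff [:c0, c1, c2, c3, c4:] 1 = c1"
    "coeff [:c0, c1, c2, c3, c4:] (Suc 0) = c1"
    "coeff [:c0, c1, c2, c3, c4:] 2 = c2" "coeff [:c0, c1, c2, c3, c4:] 3 = c3"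
    "coeff [:c0, c1, c2, c3, c4:] 4 = c4" for c0 c1 c2 c3 c4 :: complex
    by (simp_all add: eval_nat_numeral)
  show "(y - x) * (z - x) * (z - y) * bil (contract (third L K W) z) x y =
      - det3 (row L K W x) (row L K W y) (row L K W z) / 4"
    unfolding L K W bil_def contract_def third_def minor_def det3_def row_def Let_def
    by (simp add: c, simp add: divide_simps, algebra)
  show "(z - x)\<^sup>2 * bil (contract (third L K W) z) x z =
      - det3 (row L K W x) (row L K W z) (row (pderiv L) (pderiv K) (pderiv W) z) / 4"
    unfolding L K W bil_def contract_def third_def minor_def det3_def row_def Let_def
    by (simp add: c pderiv_pCons, simp add: divide_simps, algebra)
qed

section \<open>Annihilation of \<open>L, K, W\<close> by the matrix of minors\<close>

lemma less_5_cases: "(m :: nat) < 5 \<Longrightarrow> m = 0 \<or> m = 1 \<or> m = 2 \<or> m = 3 \<or> m = 4"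
  by linarith

lemma Amat_third:
  fixes L K W
  defines "A \<equiv> Amat (third L K W)" and "n \<equiv> minor L K W"
  shows "A 0 0 = 0" "A 0 1 = - n 2 3 4" "A 0 2 = n 1 3 4" "A 0 3 = - n 1 2 4" "A 0 4 = n 1 2 3"
    "A 1 0 = n 2 3 4" "A 1 1 = 0" "A 1 2 = - n 0 3 4" "A 1 3 = n 0 2 4" "A 1 4 = - n 0 2 3"
    "A 2 0 = - n 1 3 4" "A 2 1 = n 0 3 4" "A 2 2 = 0" "A 2 3 = - n 0 1 4" "A 2 4 = n 0 1 3"
    "A 3 0 = n 1 2 4" "A 3 1 = - n 0 2 4" "A 3 2 = n 0 1 4" "A 3 3 = 0" "A 3 4 = - n 0 1 2"
    "A 4 0 = - n 1 2 3" "A 4 1 = n 0 2 3" "A 4 2 = - n 0 1 3" "A 4 3 = n 0 1 2" "A 4 4 = 0"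
  by (simp_all add: A_def n_def Amat_def third_def Let_def)

text \<open>Up to sign, each sum is the Laplace expansion of a \<open>4 \<times> 4\<close>
  determinant with rows \<open>c, L, K, W\<close> and column \<open>k\<close> omitted; one row
  occurs twice.\<close>

lemma coeff_Amat_third:
  assumes "c \<in> {L, K, W}" "k < 5"
  shows "(\<Sum>j<5. coeff c j * Amat (third L K W) j k) = 0"
proof -
  let ?S = "\<lambda>c k. \<Sum>j<5. coeff c j * Amat (third L K W) j k"
  have "?S L 0 = 0" "?S L 1 = 0" "?S L 2 = 0" "?S L 3 = 0" "?S L 4 = 0"
    "?S K 0 = 0" "?S K 1 = 0" "?S K 2 = 0" "?S K 3 = 0" "?S K 4 = 0"
    "?S W 0 = 0" "?S W 1 = 0" "?S W 2 = 0" "?S W 3 = 0" "?S W 4 = 0"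
    by (simp_all only: sum_lessThan_5 Amat_third minor_def) algebra+
  then show ?thesis using assms less_5_cases [OF \<open>k < 5\<close>] by blast
qed

lemma rank3_Amat_third:
  assumes "k < 5"
  shows "(\<Sum>j<5. rank3 L K W i j * Amat (third L K W) j k) = 0"
proof -
  let ?A = "Amat (third L K W)"
  have "(\<Sum>j<5. rank3 L K W i j * ?A j k) = coeff L i * (\<Sum>j<5. coeff L j * ?A j k)
      + (coeff K i * (\<Sum>j<5. coeff W j * ?A j k) + coeff W i * (\<Sum>j<5. coeff K j * ?A j k)) / 2"
    unfolding rank3_def sum_lessThan_5 by (simp add: algebra_simps add_divide_distrib)
  then show ?thesis using coeff_Amat_third [OF _ assms, of _ L K W] by simp
qed

text \<open>For each \<open>x\<close> in \<open>Z\<close>, \<open>d1\<close> and \<open>d2\<close>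
  give the form of \<open>contract q x\<close> at all six pairs, with the values that
  \<open>third\<close> has there. Hence the contractions agree, and since they are quadratic in
  \<open>x\<close> and agree at four points, \<open>q\<close> and \<open>third\<close>
  coincide.\<close>

lemma hmat_Amat_eq_zero:
  assumes f: "fpoly a = L\<^sup>2 + K * W" and deg: "degree L \<le> 4" "degree K \<le> 4" "degree W \<le> 4"
    and Z: "card Z = 4" "\<And>z. z \<in> Z \<Longrightarrow> poly W z = 0"
    and h: "\<And>z w. z \<in> Z \<Longrightarrow> w \<in> Z \<Longrightarrow> z \<noteq> w \<Longrightarrow> hform (hmat a p) z w = poly L z * poly L w"
    and d1: "\<And>z w x. x \<in> Z \<Longrightarrow> z \<in> Z \<Longrightarrow> w \<in> Z \<Longrightarrow> z \<noteq> w \<Longrightarrow> z \<noteq> x \<Longrightarrow> w \<noteq> x \<Longrightarrow> bil (contract q x) z w = 0"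
    and d2: "\<And>z x. x \<in> Z \<Longrightarrow> z \<in> Z \<Longrightarrow> z \<noteq> x \<Longrightarrow>
       4 * (z - x)\<^sup>2 * bil (contract q x) z x = poly (pderiv W) x * (poly K z * poly L x - poly L z * poly K x)"
    and ik: "i < 5" "k < 5"
  shows "(\<Sum>j<5. hmat a p i j * Amat q j k) = 0"
proof -
  let ?t = "third L K W"
  have bil_eq: "bil (contract q x) z w = bil (contract ?t x) z w"
    if x: "x \<in> Z" and zw: "z \<in> Z" "w \<in> Z" "z \<noteq> w" for x z w
  proof -
    have swap: "bil r z w = bil r w z" for r z w by (simp add: bil_def algebra_simps)
    have diag: "bil (contract q x) z x = bil (contract ?t x) z x" if "z \<in> Z" "z \<noteq> x" for z
    proof -
      have "4 * (z - x)\<^sup>2 * bil (contract ?t x) z x = poly (pderiv W) x * (poly K z * poly L x - poly L z * poly K x)"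
        using bil_third(2) [OF deg, of x z] Z(2) [OF x] Z(2) [OF that(1)]
        by (simp add: det3_def row_def power2_commute field_simps)
      then have "4 * (z - x)\<^sup>2 * bil (contract ?t x) z x = 4 * (z - x)\<^sup>2 * bil (contract q x) z x"
        using d2 [OF x that] by simp
      then show ?thesis using that by simp
    qed
    consider "w = x" | "z = x" | "z \<noteq> x" "w \<noteq> x" by blast
    then show ?thesis
    proof cases
      case 1
      then show ?thesis using diag zw by simp
    next
      case 2
      then show ?thesis using diag [of w] zw swap [of _ z w] by simp
    next
      case 3
      \<comment> \<open>All three points are roots of \<open>W\<close>, so the determinant has a
        zero column.\<close>
      have "(w - z) * (x - z) * (x - w) * bil (contract ?t x) z w = 0"
        using bil_third(1) [OF deg, of w z x] Z(2) x zw by (simp add: det3_def row_def)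
      then show ?thesis using d1 [OF x zw] 3 zw(3) by auto
    qed
  qed
  have ct: "contract q x i j = contract ?t x i j" if x: "x \<in> Z" and ij: "(i, j) \<in> {(1,1),(1,2),(1,3),(2,2),(2,3),(3,3)}" for x i j
  proof -
    have "bil (\<lambda>i j. contract q x i j - contract ?t x i j) z w = 0" if "z \<in> Z" "w \<in> Z" "z \<noteq> w" for z w
      using bil_eq [OF x that] by (simp add: bil_diff)
    from bil_eq_zero [OF Z(1) this] ij show ?thesis by auto
  qed
  have "q i j 1 - ?t i j 1 = 0 \<and> q i j 2 - ?t i j 2 = 0 \<and> q i j 3 - ?t i j 3 = 0"
    if "(i, j) \<in> {(1,1),(1,2),(1,3),(2,2),(2,3),(3,3)}" for i j
  proof (rule quadratic_three_roots)
    show "3 \<le> card Z" using Z by simp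
    show "q i j 1 - ?t i j 1 + (q i j 2 - ?t i j 2) * x + (q i j 3 - ?t i j 3) * x\<^sup>2 = 0" if "x \<in> Z" for x
      using ct [OF that \<open>(i, j) \<in> _\<close>] by (simp add: contract_def algebra_simps)
  qed
  from this [of 1 1] this [of 1 2] this [of 1 3] this [of 2 2] this [of 2 3] this [of 3 3]
  have "Amat q j k = Amat ?t j k" for j k
    unfolding Amat_def by simp
  moreover have "hmat a p i j = rank3 L K W i j" if "j < 5" for j
    using hmat_eq_rank3 [OF f deg Z h ik(1) that] by blast
  ultimately have "(\<Sum>j<5. hmat a p i j * Amat q j k) = (\<Sum>j<5. rank3 L K W i j * Amat ?t j k)"
    by (intro sum.cong) auto
  then show ?thesis using rank3_Amat_third [OF ik(2)] by simp
qed

section \<open>Holomorphic functions of three variables\<close>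

lemma upd3_add: "upd3 k (s + t) u = upd3 k t (upd3 k s u)"
  by (simp add: upd3_def add3_def algebra_simps)

lemma upd3_zero [simp]: "upd3 k 0 u = u"
  by (simp add: upd3_def add3_def)

lemma upd3_diff: "upd3 k t u - upd3 k t v = u - v"
  by (cases u, cases v) (simp add: upd3_def add3_def)

lemma dist_upd3 [simp]: "dist (upd3 k t u) u = norm t"
  by (cases u) (simp add: upd3_def add3_def dist_norm norm_Pair)

lemma holo3_has_field_derivative:
  assumes "holo3 F D" "k \<in> {1,2,3}" "upd3 k s u \<in> D"
  shows "((\<lambda>t. F (upd3 k t u)) has_field_derivative pderiv3 F k (upd3 k s u)) (at s)"
proof -
  have "((\<lambda>t. F (upd3 k t (upd3 k s u))) has_field_derivative pderiv3 F k (upd3 k s u)) (at 0)"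
    using assms unfolding holo3_def pderiv3_def DERIV_deriv_iff_field_differentiable by blast
  then have "((\<lambda>t. F (upd3 k (s + t) u)) has_field_derivative pderiv3 F k (upd3 k s u)) (at 0)"
    by (simp add: upd3_add)
  then show ?thesis
    using DERIV_shift [of "\<lambda>t. F (upd3 k t u)" _ 0 s] by (simp add: add.commute)
qed

text \<open>Uniform continuity of \<open>F\<close> on a compact ball makes two nearby parallel
  slices uniformly close, and Cauchy's inequality for their difference carries this over to the
  derivatives.\<close>

lemma continuous_on_pderiv3:
  assumes F: "holo3 F D" and D: "open D" and k: "k \<in> {1,2,3}"
  shows "continuous_on D (pderiv3 F k)"
  unfolding continuous_on_iff
proof (intro ballI allI impI)
  fix u0 and e :: real
  assume u0: "u0 \<in> D" and e: "e > 0"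
  obtain R where R: "R > 0" "cball u0 R \<subseteq> D" using D u0 open_contains_cball by blast
  \<comment> \<open>Discs of radius \<open>r\<close> about points within \<open>r\<close> of
    \<open>u0\<close> stay in the ball of radius \<open>R\<close>.\<close>
  define r where "r = R / 2"
  have r: "r > 0" using R by (simp add: r_def)
  have "uniformly_continuous_on (cball u0 R) F"
    using F R unfolding holo3_def by (meson compact_cball compact_uniformly_continuous continuous_on_subset)
  then obtain d where d: "d > 0" "\<And>u v. u \<in> cball u0 R \<Longrightarrow> v \<in> cball u0 R \<Longrightarrow> dist u v < d \<Longrightarrow> dist (F u) (F v) < e * r / 2"
    unfolding uniformly_continuous_on_def using e r by (metis half_gt_zero mult_pos_pos)
  have "dist (pderiv3 F k u) (pderiv3 F k u0) < e" if u: "u \<in> D" "dist u u0 < min d r" for u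
  proof -
    let ?g = "\<lambda>t. F (upd3 k t u) - F (upd3 k t u0)"
    have inR: "upd3 k t v \<in> cball u0 R" if "norm t \<le> r" "dist v u0 < r \<or> v = u0" for t v
    proof -
      have "dist (upd3 k t v) u0 \<le> norm t + dist v u0"
        using dist_triangle [of "upd3 k t v" u0 v] by simp
      also have "\<dots> \<le> R" using that r by (auto simp: r_def)
      finally show ?thesis by (simp add: dist_commute)
    qed
    have D': "(?g has_field_derivative pderiv3 F k (upd3 k t u) - pderiv3 F k (upd3 k t u0)) (at t)" if "norm t \<le> r" for t
    proof -
      have "upd3 k t u \<in> D" "upd3 k t u0 \<in> D"
        using subsetD [OF R(2) inR [OF that, of u]] subsetD [OF R(2) inR [OF that, of u0]] u(2) by simp_all
      then show ?thesis by (intro DERIV_diff holo3_has_field_derivative [OF F k])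
    qed
    have "norm ((deriv ^^ 1) ?g 0) \<le> fact 1 * (e * r / 2) / r ^ 1"
    proof (rule Cauchy_inequality)
      show "?g holomorphic_on ball 0 r"
        unfolding holomorphic_on_def
      proof
        fix t assume "t \<in> ball (0 :: complex) r"
        then have "norm t \<le> r" by simp
        then show "?g field_differentiable (at t within ball 0 r)"
          using D' field_differentiable_at_within field_differentiable_def by blast
      qed
      show "continuous_on (cball 0 r) ?g"
        using D' by (intro continuous_at_imp_continuous_on ballI DERIV_isCont) auto
      show "norm (?g t) \<le> e * r / 2" if "norm (0 - t) = r" for t
      proof -
        have "dist (upd3 k t u) (upd3 k t u0) < d" using u by (simp add: dist_norm upd3_diff)
        then have "dist (F (upd3 k t u)) (F (upd3 k t u0)) < e * r / 2"
          using inR [of t u] inR [of t u0] u that by (intro d(2)) auto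
        then show ?thesis by (simp add: dist_norm)
      qed
    qed (use r in auto)
    moreover have "deriv ?g 0 = pderiv3 F k u - pderiv3 F k u0"
      using D' [of 0] r by (simp add: DERIV_imp_deriv)
    ultimately have "norm (pderiv3 F k u - pderiv3 F k u0) \<le> e / 2" using r by simp
    then show ?thesis using e by (simp add: dist_norm)
  qed
  then show "\<exists>d>0. \<forall>u\<in>D. dist u u0 < d \<longrightarrow> dist (pderiv3 F k u) (pderiv3 F k u0) < e"
    using d r by (intro exI [of _ "min d r"]) auto
qed

lemma holo3_increment:
  assumes F: "holo3 F D" and k: "k \<in> {1,2,3}"
    and B: "\<And>t. norm t \<le> norm h \<Longrightarrow> upd3 k t u \<in> D \<and> norm (pderiv3 F k (upd3 k t u) - p) \<le> e"
  shows "norm (F (upd3 k h u) - F u - p * h) \<le> e * norm h"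
proof -
  let ?g = "\<lambda>t. F (upd3 k t u) - p * t"
  have "norm (?g h - ?g 0) \<le> e * norm (h - 0)"
  proof (rule field_differentiable_bound [of "cball 0 (norm h)" ?g "\<lambda>t. pderiv3 F k (upd3 k t u) - p"])
    show "(?g has_field_derivative pderiv3 F k (upd3 k t u) - p) (at t within cball 0 (norm h))" if "t \<in> cball 0 (norm h)" for t
    proof -
      have "upd3 k t u \<in> D" using B that by simp
      then have "((\<lambda>t. F (upd3 k t u)) has_field_derivative pderiv3 F k (upd3 k t u)) (at t)"
        by (rule holo3_has_field_derivative [OF F k])
      from DERIV_diff [OF this DERIV_cmult_Id [of p]] show ?thesis
        by (rule has_field_derivative_at_within)
    qed
  qed (use B in simp_all)
  then show ?thesis by (simp add: algebra_simps)
qed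

lemma norm_le_cvec3: "norm p \<le> norm (p, q, r)" "norm q \<le> norm (p, q, r)" "norm r \<le> norm (p, q, r)"
  for p q r :: complex
  by (auto simp: norm_Pair intro!: real_le_rsqrt real_sqrt_le_mono)

text \<open>Continuous partial derivatives give a total one: go from \<open>u0\<close> to
  \<open>u\<close> one coordinate at a time, each leg with error at most \<open>e / 3\<close> times
  the full distance.\<close>

lemma holo3_has_derivative:
  assumes F: "holo3 F D" and D: "open D" and u0: "u0 \<in> D"
  shows "(F has_derivative (\<lambda>h. pderiv3 F 1 u0 * fst h + pderiv3 F 2 u0 * fst (snd h) + pderiv3 F 3 u0 * snd (snd h))) (at u0)"
    (is "(F has_derivative ?L) _")
  unfolding has_derivative_at_alt
proof (intro conjI allI impI)
  show "bounded_linear ?L" by (intro bounded_linear_intros)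
  fix e :: real assume e: "e > 0"
  have ev: "\<forall>\<^sub>F u in nhds u0. norm (pderiv3 F k u - pderiv3 F k u0) < e / 3" if "k \<in> {1,2,3}" for k
  proof -
    have "isCont (pderiv3 F k) u0"
      using continuous_on_pderiv3 [OF F D that] D u0 continuous_on_eq_continuous_at by blast
    then show ?thesis
      using e unfolding continuous_at_eps_delta eventually_nhds_metric dist_norm by (metis zero_less_divide_iff zero_less_numeral)
  qed
  have "\<forall>\<^sub>F u in nhds u0. u \<in> D \<and> (\<forall>k\<in>{1,2,3}. norm (pderiv3 F k u - pderiv3 F k u0) < e / 3)"
    using ev [of 1] ev [of 2] ev [of 3] eventually_nhds_in_open [OF D u0]
    by (simp add: eventually_conj_iff)
  then obtain d where d: "d > 0"
    and B: "\<And>u k. dist u u0 < d \<Longrightarrow> k \<in> {1,2,3} \<Longrightarrow> u \<in> D \<and> norm (pderiv3 F k u - pderiv3 F k u0) \<le> e / 3"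
    unfolding eventually_nhds_metric by (meson less_imp_le)
  have "norm (F u - F u0 - ?L (u - u0)) \<le> e * norm (u - u0)" if u: "norm (u - u0) < d" for u
  proof -
    obtain p q r where h: "u - u0 = (p, q, r)" by (cases "u - u0")
    have n: "norm (p, q, r) < d" using u h by simp
    let ?u1 = "upd3 1 p u0" let ?u2 = "upd3 2 q ?u1" let ?u3 = "upd3 3 r ?u2"
    have near: "dist (upd3 1 t u0) u0 < d" if "norm t \<le> norm p" for t
      using that norm_le_cvec3(1) [where p = p and q = q and r = r] n by simp
    have near2: "dist (upd3 2 t ?u1) u0 < d" if "norm t \<le> norm q" for t
    proof -
      have "upd3 2 t ?u1 - u0 = (p, t, 0)" by (cases u0) (simp add: upd3_def add3_def)
      moreover have "norm (p, t, 0 :: complex) \<le> norm (p, q, r)"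
        using power_mono [OF that norm_ge_zero, of 2] by (simp add: norm_Pair add_increasing2)
      ultimately show ?thesis using n by (simp add: dist_norm)
    qed
    have near3: "dist (upd3 3 t ?u2) u0 < d" if "norm t \<le> norm r" for t
    proof -
      have "upd3 3 t ?u2 - u0 = (p, q, t)" by (cases u0) (simp add: upd3_def add3_def)
      moreover have "norm (p, q, t) \<le> norm (p, q, r)"
        using that by (auto simp: norm_Pair intro!: real_sqrt_le_mono add_mono power_mono)
      ultimately show ?thesis using n by (simp add: dist_norm)
    qed
    have "u = u0 + (p, q, r)" using h by (metis add_diff_cancel_left' diff_add_cancel add.commute)
    then have u3: "?u3 = u" by (cases u0) (simp add: upd3_def add3_def)
    let ?N = "e / 3 * norm (p, q, r)"
    have N: "e / 3 * norm p \<le> ?N" "e / 3 * norm q \<le> ?N" "e / 3 * norm r \<le> ?N"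
      using e norm_le_cvec3 by (auto intro!: mult_left_mono)
    have "norm (F ?u1 - F u0 - pderiv3 F 1 u0 * p) \<le> e / 3 * norm p"
      by (rule holo3_increment [OF F]) (simp, rule B [OF near], assumption, simp)
    then have 1: "norm (F ?u1 - F u0 - pderiv3 F 1 u0 * p) \<le> ?N" using N(1) by (rule order_trans)
    have "norm (F ?u2 - F ?u1 - pderiv3 F 2 u0 * q) \<le> e / 3 * norm q"
      by (rule holo3_increment [OF F]) (simp, rule B [OF near2], assumption, simp)
    then have 2: "norm (F ?u2 - F ?u1 - pderiv3 F 2 u0 * q) \<le> ?N" using N(2) by (rule order_trans)
    have "norm (F ?u3 - F ?u2 - pderiv3 F 3 u0 * r) \<le> e / 3 * norm r"
      by (rule holo3_increment [OF F]) (simp, rule B [OF near3], assumption, simp)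
    then have 3: "norm (F ?u3 - F ?u2 - pderiv3 F 3 u0 * r) \<le> ?N" using N(3) by (rule order_trans)
    have "F u - F u0 - ?L (u - u0) = (F ?u1 - F u0 - pderiv3 F 1 u0 * p)
        + (F ?u2 - F ?u1 - pderiv3 F 2 u0 * q) + (F ?u3 - F ?u2 - pderiv3 F 3 u0 * r)"
      unfolding u3 h by (simp add: algebra_simps)
    then have "norm (F u - F u0 - ?L (u - u0)) \<le> ?N + ?N + ?N"
      using norm_triangle_mono [OF norm_triangle_mono [OF 1 2] 3] by (simp only:)
    then show ?thesis unfolding h by (simp add: field_simps)
  qed
  with d show "\<exists>d>0. \<forall>y. norm (y - u0) < d \<longrightarrow> norm (F y - F u0 - ?L (y - u0)) \<le> e * norm (y - u0)" by blast
qed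

lemma holo3_chain:
  assumes F: "holo3 F D" and D: "open D" and w: "w x \<in> D"
    and dw: "\<And>k. k \<in> {1,2,3} \<Longrightarrow> ((\<lambda>t. coord3 k (w t)) has_field_derivative d k) (at x)"
  shows "((\<lambda>t. F (w t)) has_field_derivative
     pderiv3 F 1 (w x) * d 1 + pderiv3 F 2 (w x) * d 2 + pderiv3 F 3 (w x) * d 3) (at x)"
proof -
  have "(w has_derivative (\<lambda>t. (d 1 * t, d 2 * t, d 3 * t))) (at x)"
    using has_derivative_Pair [OF dw [of 1, unfolded has_field_derivative_def]
        has_derivative_Pair [OF dw [of 2, unfolded has_field_derivative_def] dw [of 3, unfolded has_field_derivative_def]]]
    by (simp add: coord3_def)
  from has_derivative_compose [OF this holo3_has_derivative [OF F D w]]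
  show ?thesis unfolding has_field_derivative_def
    by (rule has_derivative_eq_rhs) (auto simp: algebra_simps)
qed

section \<open>Continuity of the matrix entries and derivatives of \<open>bil\<close>\<close>

lemma continuous_on_hmat:
  assumes "\<And>i j. i \<in> {1,2,3} \<Longrightarrow> j \<in> {1,2,3} \<Longrightarrow> continuous_on D (p i j)" "i < 5" "j < 5"
  shows "continuous_on D (\<lambda>u. hmat a (\<lambda>i j. p i j u) i j)"
proof -
  have c: "continuous_on D (\<lambda>u. p i j u)" if "i \<in> {1,2,3}" "j \<in> {1,2,3}" for i j
    using assms(1) [OF that] by simp
  show ?thesis
    using less_5_cases [OF assms(2)] less_5_cases [OF assms(3)]
    by (elim disjE; simp add: hmat_def; intro continuous_on_add continuous_on_diff continuous_on_mult continuous_on_const c; simp)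
qed

lemma continuous_on_Amat:
  assumes "\<And>i j k. i \<in> {1,2,3} \<Longrightarrow> j \<in> {1,2,3} \<Longrightarrow> k \<in> {1,2,3} \<Longrightarrow> continuous_on D (q i j k)"
    "i < 5" "j < 5"
  shows "continuous_on D (\<lambda>u. Amat (\<lambda>i j k. q i j k u) i j)"
proof -
  have c: "continuous_on D (q 1 1 1)" "continuous_on D (q 1 1 2)" "continuous_on D (q 1 1 3)"
    "continuous_on D (q 1 2 2)" "continuous_on D (q 1 2 3)" "continuous_on D (q 1 3 3)"
    "continuous_on D (q 2 2 2)" "continuous_on D (q 2 2 3)" "continuous_on D (q 2 3 3)" "continuous_on D (q 3 3 3)"
    using assms(1) by simp_all
  show ?thesis
    using less_5_cases [OF assms(2)] less_5_cases [OF assms(3)] unfolding Amat_def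
    by (elim disjE; simp; intro continuous_on_add continuous_on_diff continuous_on_minus continuous_on_mult
        continuous_on_const c [unfolded One_nat_def])
qed

lemma bil_divide: "bil (\<lambda>i j. p i j / y) z w = bil p z w / y"
  by (simp add: bil_def add_divide_distrib)

lemma bil_has_field_derivative_fixed:
  assumes "\<And>i j. i \<in> {1,2,3} \<Longrightarrow> j \<in> {1,2,3} \<Longrightarrow> ((\<lambda>t. g t i j) has_field_derivative g' i j) (at x)"
  shows "((\<lambda>t. bil (g t) z w) has_field_derivative bil g' z w) (at x)"
proof -
  have "((\<lambda>t. g t 1 1) has_field_derivative g' 1 1) (at x)" "((\<lambda>t. g t 1 2) has_field_derivative g' 1 2) (at x)"
    "((\<lambda>t. g t 1 3) has_field_derivative g' 1 3) (at x)" "((\<lambda>t. g t 2 2) has_field_derivative g' 2 2) (at x)"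
    "((\<lambda>t. g t 2 3) has_field_derivative g' 2 3) (at x)" "((\<lambda>t. g t 3 3) has_field_derivative g' 3 3) (at x)"
    using assms(1) by simp_all
  then show ?thesis unfolding bil_def by (intro DERIV_add DERIV_cmult_right)
qed

lemma DERIV_mult_zero:
  fixes f m :: "complex \<Rightarrow> complex"
  assumes "(f has_field_derivative D) (at x)" "f x = 0" "isCont m x"
  shows "((\<lambda>t. f t * m t) has_field_derivative D * m x) (at x)"
proof -
  have "((\<lambda>t. (f t - f x) / (t - x) * m t) \<longlongrightarrow> D * m x) (at x)"
    using assms by (intro tendsto_mult) (auto simp: has_field_derivative_iff isCont_def)
  then show ?thesis
    using assms(2) by (simp add: has_field_derivative_iff)
qed

text \<open>The coefficients \<open>g\<close> vanish at \<open>x\<close>, so the variation of the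
  monomials in the moving argument contributes nothing to first order.\<close>

lemma bil_has_field_derivative_moving:
  assumes "\<And>i j. i \<in> {1,2,3} \<Longrightarrow> j \<in> {1,2,3} \<Longrightarrow> ((\<lambda>t. g t i j) has_field_derivative g' i j) (at x)"
    and "\<And>i j. g x i j = 0"
  shows "((\<lambda>t. bil (g t) z t) has_field_derivative bil g' z x) (at x)"
proof -
  have *: "((\<lambda>t. g t i j * m t) has_field_derivative g' i j * m x) (at x)"
    if "i \<in> {1,2,3}" "j \<in> {1,2,3}" "isCont m x" for i j m
    using that assms by (intro DERIV_mult_zero)
  have "((\<lambda>t. g t 1 1) has_field_derivative g' 1 1) (at x)" using assms(1) by simp
  moreover have "((\<lambda>t. g t 1 2 * (z + t)) has_field_derivative g' 1 2 * (z + x)) (at x)"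
      "((\<lambda>t. g t 1 3 * (z\<^sup>2 + t\<^sup>2)) has_field_derivative g' 1 3 * (z\<^sup>2 + x\<^sup>2)) (at x)"
      "((\<lambda>t. g t 2 2 * (z * t)) has_field_derivative g' 2 2 * (z * x)) (at x)"
      "((\<lambda>t. g t 2 3 * (z * t * (z + t))) has_field_derivative g' 2 3 * (z * x * (z + x))) (at x)"
      "((\<lambda>t. g t 3 3 * (z\<^sup>2 * t\<^sup>2)) has_field_derivative g' 3 3 * (z\<^sup>2 * x\<^sup>2)) (at x)"
    by (rule *; simp)+
  ultimately show ?thesis unfolding bil_def by (intro DERIV_add)
qed

section \<open>The defining relations and their derivatives\<close>

locale wp_functions =
  fixes a :: "nat \<Rightarrow> complex" and wp :: "nat \<Rightarrow> nat \<Rightarrow> cvec3 \<Rightarrow> complex"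
    and D :: "cvec3 set" and x0 y0 :: complex and c :: cvec3
  assumes deg: "a 8 \<noteq> 0"
    and nonsing: "\<And>x. fC a x = 0 \<Longrightarrow> fC' a x \<noteq> 0"
    and D_open: "open D"
    and holo: "\<And>i j. i \<in> {1,2,3} \<Longrightarrow> j \<in> {1,2,3} \<Longrightarrow> holo3 (wp i j) D"
    and base: "y0\<^sup>2 = fC a x0" "y0 \<noteq> 0"
    and defining:
      "\<And>x y x1 y1 x2 y2 x3 y3 gx gy gx1 gy1 gx2 gy2 gx3 gy3 u.
         curve_path a gx gy (x0, y0) (x, y) \<Longrightarrow>
         curve_path a gx1 gy1 (x0, y0) (x1, y1) \<Longrightarrow>
         curve_path a gx2 gy2 (x0, y0) (x2, y2) \<Longrightarrow>
         curve_path a gx3 gy3 (x0, y0) (x3, y3) \<Longrightarrow>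
         u = add3 c (add3 (abel gx gy) (add3 (abel gx1 gy1) (add3 (abel gx2 gy2) (abel gx3 gy3)))) \<Longrightarrow>
         u \<in> D \<Longrightarrow>
         y * y1 - hform (hmat a (\<lambda>i j. wp i j u)) x x1 = 0"
begin

text \<open>The four points may be listed in any order, so the relation between the first two yields
  every pair.\<close>

lemma hform_at_pair:
  assumes Z: "card Z = 4" and r: "\<And>z. z \<in> Z \<Longrightarrow> reach a (x0, y0) z (\<eta> z) (V z)"
    and u: "u = c + (\<Sum>z\<in>Z. V z)" "u \<in> D" and zw: "z \<in> Z" "w \<in> Z" "z \<noteq> w"
  shows "hform (hmat a (\<lambda>i j. wp i j u)) z w = \<eta> z * \<eta> w"
proof -
  have fin: "finite Z" using Z card.infinite by fastforce
  have "card (Z - {z} - {w}) = 2" using Z zw fin by simp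
  then obtain s t where st: "Z - {z} - {w} = {s, t}" "s \<noteq> t" by (auto simp: card_2_iff)
  then have Zeq: "Z = {z, w, s, t}" "z \<noteq> s" "z \<noteq> t" "w \<noteq> s" "w \<noteq> t" using zw by blast+
  obtain gx gy where g: "curve_path a gx gy (x0, y0) (z, \<eta> z)" "abel gx gy = V z"
    using reach_imp_abel [OF r [of z]] zw by blast
  obtain gx1 gy1 where g1: "curve_path a gx1 gy1 (x0, y0) (w, \<eta> w)" "abel gx1 gy1 = V w"
    using reach_imp_abel [OF r [of w]] zw by blast
  obtain gx2 gy2 where g2: "curve_path a gx2 gy2 (x0, y0) (s, \<eta> s)" "abel gx2 gy2 = V s"
    using reach_imp_abel [OF r [of s]] Zeq by blast
  obtain gx3 gy3 where g3: "curve_path a gx3 gy3 (x0, y0) (t, \<eta> t)" "abel gx3 gy3 = V t"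
    using reach_imp_abel [OF r [of t]] Zeq by blast
  have "u = add3 c (add3 (abel gx gy) (add3 (abel gx1 gy1) (add3 (abel gx2 gy2) (abel gx3 gy3))))"
    using u(1) zw(3) Zeq(2-) st(2) unfolding Zeq(1) by (simp add: add3_eq_plus g g1 g2 g3)
  from defining [OF g(1) g1(1) g2(1) g3(1) this u(2)] show ?thesis by simp
qed

text \<open>For \<open>t\<close> near \<open>x\<close> the shifted vector stays in the open set
  \<open>D\<close> and \<open>t\<close> avoids the other three abscissae. The filter
  \<open>nhds\<close> includes \<open>t = x\<close>, as needed to transfer derivatives at
  \<open>x\<close>.\<close>

lemma moving_point:
  assumes Z: "card Z = 4" and r: "\<And>z. z \<in> Z \<Longrightarrow> reach a (x0, y0) z (\<eta> z) (V z)"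
    and u: "u = c + (\<Sum>z\<in>Z. V z)" "u \<in> D" and x: "x \<in> Z"
    and br: "local_branch a U Y \<Phi>" "x \<in> U" "Y x = \<eta> x"
  shows "\<forall>\<^sub>F t in nhds x.
    (\<forall>z\<in>Z - {x}. hform (hmat a (\<lambda>i j. wp i j (u + (\<Phi> t - \<Phi> x)))) z t = \<eta> z * Y t \<and>
      (\<forall>w\<in>Z - {x}. z \<noteq> w \<longrightarrow> hform (hmat a (\<lambda>i j. wp i j (u + (\<Phi> t - \<Phi> x)))) z w = \<eta> z * \<eta> w))"
proof -
  have fin: "finite Z" using Z card.infinite by fastforce
  have U: "open U" using br unfolding local_branch_def by blast
  have "isCont \<Phi> x"
    using continuous_on_branch [OF br(1)] br(2) U continuous_on_eq_continuous_at by blast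
  then have "isCont (\<lambda>t. u + (\<Phi> t - \<Phi> x)) x" by (intro continuous_intros)
  then have "((\<lambda>t. u + (\<Phi> t - \<Phi> x)) \<longlongrightarrow> u) (nhds x)"
    by (simp add: isCont_def tendsto_nhds_iff)
  then have "\<forall>\<^sub>F t in nhds x. u + (\<Phi> t - \<Phi> x) \<in> D"
    using D_open u(2) by (rule topological_tendstoD)
  moreover have "\<forall>\<^sub>F t in nhds x. t \<in> U - (Z - {x})"
    using br(2) fin U by (intro eventually_nhds_in_open open_Diff finite_imp_closed) auto
  ultimately show ?thesis
  proof eventually_elim
    case (elim t)
    define Z' \<eta>' V' where "Z' = insert t (Z - {x})" and "\<eta>' = \<eta> (t := Y t)" and "V' = V (t := V x + \<Phi> t - \<Phi> x)"
    have tn: "t \<notin> Z - {x}" using elim by blast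
    have Z': "card Z' = 4" using tn Z fin x by (simp add: Z'_def)
    have r': "reach a (x0, y0) z (\<eta>' z) (V' z)" if "z \<in> Z'" for z
    proof (cases "z = t")
      case True
      have "reach a (x0, y0) x (Y x) (V x)" using r [OF x] br(3) by simp
      from reach_extend [OF br(1,2) _ this, of t] True elim show ?thesis by (simp add: \<eta>'_def V'_def)
    next
      case False
      with that r show ?thesis by (auto simp: Z'_def \<eta>'_def V'_def)
    qed
    have "(\<Sum>z\<in>Z'. V' z) = V' t + (\<Sum>z\<in>Z - {x}. V' z)"
      unfolding Z'_def using tn fin by (intro sum.insert) auto
    also have "(\<Sum>z\<in>Z - {x}. V' z) = (\<Sum>z\<in>Z - {x}. V z)"
      using tn by (intro sum.cong) (auto simp: V'_def)
    also have "\<dots> = (\<Sum>z\<in>Z. V z) - V x" using x fin by (simp add: sum_diff1)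
    finally have u': "u + (\<Phi> t - \<Phi> x) = c + (\<Sum>z\<in>Z'. V' z)" by (simp add: V'_def u(1) algebra_simps)
    have pair: "hform (hmat a (\<lambda>i j. wp i j (u + (\<Phi> t - \<Phi> x)))) z w = \<eta>' z * \<eta>' w"
      if "z \<in> Z'" "w \<in> Z'" "z \<noteq> w" for z w
      using hform_at_pair [OF Z' r' u' _ that] elim by blast
    show ?case
    proof (intro ballI conjI impI)
      fix z assume z: "z \<in> Z - {x}"
      then have zt: "z \<noteq> t" using tn by blast
      show "hform (hmat a (\<lambda>i j. wp i j (u + (\<Phi> t - \<Phi> x)))) z t = \<eta> z * Y t"
        using pair [of z t] z zt by (simp add: Z'_def \<eta>'_def)
      fix w assume w: "w \<in> Z - {x}" "z \<noteq> w"
      then have "w \<noteq> t" using tn by blast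
      then show "hform (hmat a (\<lambda>i j. wp i j (u + (\<Phi> t - \<Phi> x)))) z w = \<eta> z * \<eta> w"
        using pair [of z w] z w zt by (simp add: Z'_def \<eta>'_def)
    qed
  qed
qed

lemma hmat_Amat_at_quad_sum:
  assumes v: "v \<in> quad_sums a (x0, y0)" and uD: "c + v \<in> D" and ik: "i < 5" "k < 5"
  shows "(\<Sum>j<5. hmat a (\<lambda>p q. wp p q (c + v)) i j * Amat (\<lambda>p q r. pderiv3 (wp p q) r (c + v)) j k) = 0"
proof -
  obtain Z \<eta> V where Z: "card Z = 4" and r: "\<And>z. z \<in> Z \<Longrightarrow> reach a (x0, y0) z (\<eta> z) (V z)" and v: "v = (\<Sum>z\<in>Z. V z)"
    using v unfolding quad_sums_def by blast
  define u where "u = c + v"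
  have u: "u = c + (\<Sum>z\<in>Z. V z)" "u \<in> D" using v uD by (simp_all add: u_def)
  have fin: "finite Z" using Z card.infinite by fastforce
  have \<eta>: "(\<eta> z)\<^sup>2 = fC a z" "\<eta> z \<noteq> 0" if "z \<in> Z" for z using reach_point [OF r [OF that]] by auto
  define W where "W = root_poly Z"
  obtain L K where LK: "fpoly a = L\<^sup>2 + K * W" "degree L \<le> 3" "degree K = 4" "coeff K 4 = a 8"
    "\<And>z. z \<in> Z \<Longrightarrow> poly L z = \<eta> z"
    using interpolation_factorization [of a Z \<eta>, OF deg Z] \<eta> unfolding W_def by blast
  \<comment> \<open>Here \<open>L\<close> interpolates the ordinates with the plus sign; the locale
    supplies the degrees and the expression of \<open>f'\<close> through
    \<open>L, K, W\<close>.\<close>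
  interpret pencil a L K W
    using deg nonsing LK Z lead_coeff_root_poly [of Z] by unfold_locales (auto simp: W_def)
  have W0: "poly W z = 0" if "z \<in> Z" for z using that fin by (simp add: W_def poly_root_poly)
  define p where "p i j = wp i j u" for i j
  define q where "q i j k = pderiv3 (wp i j) k u" for i j k
  have deg4: "degree L \<le> 4" "degree K \<le> 4" "degree W \<le> 4" using degrees by auto
  have h: "hform (hmat a p) z w = poly L z * poly L w" if "z \<in> Z" "w \<in> Z" "z \<noteq> w" for z w
    using hform_at_pair [OF Z r u that] LK(5) that unfolding p_def by simp
  have hm: "hmat a p i j = rank3 L K W i j" if "i < 5" "j < 5" for i j
    by (rule hmat_eq_rank3 [OF LK(1) deg4 Z W0 h that])
  have hr: "hform (hmat a p) z t = poly L z * poly L t + (poly K z * poly W t + poly W z * poly K t) / 2" for z t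
  proof -
    have "hform (hmat a p) z t = hform (rank3 L K W) z t"
      unfolding hform_def using hm by (intro sum.cong) auto
    then show ?thesis using hform_rank3 [OF deg4] by simp
  qed
  have key: "(\<forall>z w. z \<in> Z \<longrightarrow> w \<in> Z \<longrightarrow> z \<noteq> w \<longrightarrow> z \<noteq> x \<longrightarrow> w \<noteq> x \<longrightarrow> bil (contract q x) z w = 0) \<and>
      (\<forall>z. z \<in> Z \<longrightarrow> z \<noteq> x \<longrightarrow> 4 * (z - x)\<^sup>2 * bil (contract q x) z x =
         poly (pderiv W) x * (poly K z * poly L x - poly L z * poly K x))"
    if x: "x \<in> Z" for x
  proof -
    obtain e Y \<Phi> where e: "e > 0" and br: "local_branch a (ball x e) Y \<Phi>" and Yx: "Y x = \<eta> x"
      using local_branch_exists [OF \<eta> [OF x]] by blast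
    have xe: "x \<in> ball x e" using e by simp
    \<comment> \<open>The increments of the \<open>\<wp>\<^sub>i\<^sub>j\<close> while only the
      point over \<open>x\<close> moves; they vanish at \<open>t = x\<close>.\<close>
    define g where "g t i j = wp i j (u + (\<Phi> t - \<Phi> x)) - p i j" for t i j
    have g0: "g x i j = 0" for i j by (simp add: g_def p_def)
    have dg: "((\<lambda>t. g t i j) has_field_derivative contract q x i j / \<eta> x) (at x)"
      if ij: "i \<in> {1,2,3}" "j \<in> {1,2,3}" for i j
    proof -
      have "((\<lambda>t. coord3 k (u + (\<Phi> t - \<Phi> x))) has_field_derivative x ^ (k - 1) / \<eta> x) (at x)" if "k \<in> {1,2,3}" for k
      proof -
        have "((\<lambda>t. coord3 k (\<Phi> t)) has_field_derivative x ^ (k - 1) / \<eta> x) (at x)"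
          using br xe that Yx unfolding local_branch_def by metis
        then show ?thesis by (auto intro!: derivative_eq_intros)
      qed
      from holo3_chain [where w = "\<lambda>t. u + (\<Phi> t - \<Phi> x)" and d = "\<lambda>k. x ^ (k - 1) / \<eta> x", OF holo [OF ij] D_open _ this]
      have "((\<lambda>t. wp i j (u + (\<Phi> t - \<Phi> x))) has_field_derivative contract q x i j / \<eta> x) (at x)"
        using u(2) by (simp add: contract_def q_def add_divide_distrib)
      then show ?thesis unfolding g_def by (auto intro!: derivative_eq_intros)
    qed
    have hg: "hform (hmat a (\<lambda>i j. wp i j (u + (\<Phi> t - \<Phi> x)))) z w = hform (hmat a p) z w - 2 * (z - w)\<^sup>2 * bil (g t) z w" for t z w
      using hform_diff [of a "\<lambda>i j. wp i j (u + (\<Phi> t - \<Phi> x))" z w p]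
      unfolding g_def bil_diff by (simp add: algebra_simps)
    have ev: "\<forall>\<^sub>F t in nhds x.
        (\<forall>z\<in>Z - {x}. hform (hmat a p) z t - 2 * (z - t)\<^sup>2 * bil (g t) z t = \<eta> z * Y t \<and>
          (\<forall>w\<in>Z - {x}. z \<noteq> w \<longrightarrow> hform (hmat a p) z w - 2 * (z - w)\<^sup>2 * bil (g t) z w = \<eta> z * \<eta> w))"
      unfolding hg [symmetric] using Z r u x br xe Yx by (rule moving_point)
    have "bil (contract q x) z w = 0" if zw: "z \<in> Z" "w \<in> Z" "z \<noteq> w" "z \<noteq> x" "w \<noteq> x" for z w
    proof -
      have "\<forall>\<^sub>F t in nhds x. bil (g t) z w = 0"
        using ev
      proof eventually_elim
        case (elim t)
        then have "hform (hmat a p) z w - 2 * (z - w)\<^sup>2 * bil (g t) z w = \<eta> z * \<eta> w" using zw by blast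
        then show ?case using h [OF zw(1-3)] LK(5) zw by simp
      qed
      then have "((\<lambda>t. bil (g t) z w) has_field_derivative 0) (at x)"
        by (subst DERIV_cong_ev [OF refl _ refl]) auto
      with bil_has_field_derivative_fixed [OF dg]
      have "bil (\<lambda>i j. contract q x i j / \<eta> x) z w = 0" by (rule DERIV_unique)
      then show ?thesis using \<eta> x by (simp add: bil_divide)
    qed
    moreover have "4 * (z - x)\<^sup>2 * bil (contract q x) z x = poly (pderiv W) x * (poly K z * poly L x - poly L z * poly K x)"
      if z: "z \<in> Z" "z \<noteq> x" for z
    proof -
      \<comment> \<open>The form of \<open>h\<close> at the unmoved \<open>u\<close> is replaced by
        its rank-three expression, where \<open>W(z) = 0\<close> removes one term.\<close>
      have "\<forall>\<^sub>F t in nhds x. \<eta> z * Y t - poly L z * poly L t - poly K z * poly W t / 2 + bil (g t) z t * (2 * (z - t)\<^sup>2) = 0"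
        using ev
      proof eventually_elim
        case (elim t)
        then have "hform (hmat a p) z t - 2 * (z - t)\<^sup>2 * bil (g t) z t = \<eta> z * Y t" using z by blast
        then show ?case using W0 [OF z(1)] unfolding hr by (simp add: algebra_simps)
      qed
      then have z0: "((\<lambda>t. \<eta> z * Y t - poly L z * poly L t - poly K z * poly W t / 2 + bil (g t) z t * (2 * (z - t)\<^sup>2)) has_field_derivative 0) (at x)"
        by (subst DERIV_cong_ev [OF refl _ refl]) auto
      have dY: "(Y has_field_derivative deriv Y x) (at x)"
        using br xe unfolding local_branch_def by (metis holomorphic_derivI)
      have "((\<lambda>t. bil (g t) z t * (2 * (z - t)\<^sup>2)) has_field_derivative
          bil (\<lambda>i j. contract q x i j / \<eta> x) z x * (2 * (z - x)\<^sup>2)) (at x)"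
        by (rule DERIV_mult_zero [OF bil_has_field_derivative_moving [OF dg g0]])
          (auto simp: bil_def g0 intro!: continuous_intros)
      then have "((\<lambda>t. \<eta> z * Y t - poly L z * poly L t - poly K z * poly W t / 2 + bil (g t) z t * (2 * (z - t)\<^sup>2)) has_field_derivative
          \<eta> z * deriv Y x - poly L z * poly (pderiv L) x - poly K z * poly (pderiv W) x / 2
            + bil (\<lambda>i j. contract q x i j / \<eta> x) z x * (2 * (z - x)\<^sup>2)) (at x)"
        by (intro DERIV_add DERIV_diff DERIV_cmult DERIV_cdivide dY poly_DERIV)
      from DERIV_unique [OF this z0]
      have eq: "\<eta> z * deriv Y x - poly L z * poly (pderiv L) x - poly K z * poly (pderiv W) x / 2
            + bil (contract q x) z x / \<eta> x * (2 * (z - x)\<^sup>2) = 0"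
        by (simp only: bil_divide)
      \<comment> \<open>\<open>Y'\<close> is eliminated by differentiating \<open>Y^2 = f\<close> at
        \<open>x\<close>; there \<open>W(x) = 0\<close> drops the term with
        \<open>K'\<close>.\<close>
      have "2 * \<eta> x * deriv Y x = fC' a x"
      proof -
        have "((\<lambda>t. (Y t)\<^sup>2) has_field_derivative 2 * \<eta> x * deriv Y x) (at x)"
          using dY Yx by (auto intro!: derivative_eq_intros)
        moreover have "((\<lambda>t. (Y t)\<^sup>2) has_field_derivative fC' a x) (at x)"
        proof (rule has_field_derivative_transform_within_open [OF _ open_ball xe])
          show "(poly (fpoly a) has_field_derivative fC' a x) (at x)"
            using poly_DERIV [of "fpoly a" x] by (simp add: poly_pderiv_fpoly)
          show "poly (fpoly a) t = (Y t)\<^sup>2" if "t \<in> ball x e" for t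
            using br that unfolding local_branch_def by (simp add: poly_fpoly)
        qed
        ultimately show ?thesis by (rule DERIV_unique)
      qed
      then have dYx: "2 * poly L x * deriv Y x = 2 * poly L x * poly (pderiv L) x + poly K x * poly (pderiv W) x"
        using W0 [OF x] LK(5) [OF x] by (simp add: fC'_eq)
      have Lx: "poly L x \<noteq> 0" using LK(5) [OF x] \<eta> [OF x] by simp
      \<comment> \<open>Dividing by \<open>L(x) = \<eta> x\<close> makes the remaining identity
        polynomial; it follows on multiplying by \<open>L(x)\<close> and inserting
        \<open>dYx\<close>.\<close>
      define b where "b = bil (contract q x) z x / poly L x"
      have b: "bil (contract q x) z x = b * poly L x" using Lx by (simp add: b_def)
      have "poly L z * deriv Y x - poly L z * poly (pderiv L) x - poly K z * poly (pderiv W) x / 2 + b * (2 * (z - x)\<^sup>2) = 0"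
        using eq LK(5) x z by (simp add: b_def)
      then have "2 * (poly L z * deriv Y x) - 2 * (poly L z * poly (pderiv L) x) - poly K z * poly (pderiv W) x + 4 * b * (z - x)\<^sup>2 = 0"
        by (simp add: field_simps)
      then show ?thesis unfolding b using dYx by algebra
    qed
    ultimately show ?thesis by blast
  qed
  have "(\<Sum>j<5. hmat a p i j * Amat q j k) = 0"
    using key by (intro hmat_Amat_eq_zero [OF LK(1) deg4 Z W0 h _ _ ik]) blast+
  then show ?thesis unfolding p_def [abs_def] q_def [abs_def] u_def .
qed

text \<open>Every entry of the product is continuous on \<open>D\<close>, so a nonzero value would
  persist on an open set, which meets the dense set of sums translated by \<open>c\<close>.\<close>

lemma hmat_Amat_on_domain:
  assumes u: "u \<in> D" and ik: "i < 5" "k < 5"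
  shows "(\<Sum>j<5. hmat a (\<lambda>p q. wp p q u) i j * Amat (\<lambda>p q r. pderiv3 (wp p q) r u) j k) = 0"
proof (rule ccontr)
  let ?Q = "\<lambda>u. \<Sum>j<5. hmat a (\<lambda>p q. wp p q u) i j * Amat (\<lambda>p q r. pderiv3 (wp p q) r u) j k"
  assume nz: "?Q u \<noteq> 0"
  have "continuous_on D ?Q"
  proof (intro continuous_on_sum continuous_on_mult)
    fix j :: nat assume j: "j \<in> {..<5}"
    show "continuous_on D (\<lambda>u. hmat a (\<lambda>p q. wp p q u) i j)"
      using holo ik j by (intro continuous_on_hmat) (auto simp: holo3_def)
    show "continuous_on D (\<lambda>u. Amat (\<lambda>p q r. pderiv3 (wp p q) r u) j k)"
      using ik j by (intro continuous_on_Amat continuous_on_pderiv3 [OF holo D_open]) auto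
  qed
  then have "open (D \<inter> ?Q -` (- {0}))"
    using D_open by (intro continuous_open_preimage) auto
  then have "open ((\<lambda>v. c + v) -` (D \<inter> ?Q -` (- {0})))"
    by (intro open_vimage continuous_intros)
  moreover have "u - c \<in> (\<lambda>v. c + v) -` (D \<inter> ?Q -` (- {0}))" using u nz by simp
  moreover have "u - c \<in> closure (quad_sums a (x0, y0))"
    using closure_quad_sums [OF deg nonsing base] by simp
  ultimately obtain v where "v \<in> quad_sums a (x0, y0)" "c + v \<in> D" "?Q (c + v) \<noteq> 0"
    unfolding closure_iff_nhds_not_empty by blast
  then show False using hmat_Amat_at_quad_sum ik by blast
qed

end

theorem mainTheorem6:
  fixes a :: "nat \<Rightarrow> complex"
    and wp :: "nat \<Rightarrow> nat \<Rightarrow> cvec3 \<Rightarrow> complex"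
    and D :: "cvec3 set"
    and x0 y0 :: complex
    and c :: cvec3
  assumes deg: "a 8 \<noteq> 0"
    and nonsing: "\<And>x. fC a x = 0 \<Longrightarrow> fC' a x \<noteq> 0"
    and sym: "\<And>i j. i \<in> {1,2,3} \<Longrightarrow> j \<in> {1,2,3} \<Longrightarrow> wp i j = wp j i"
    and D_open: "open D"
    and holo: "\<And>i j. i \<in> {1,2,3} \<Longrightarrow> j \<in> {1,2,3} \<Longrightarrow> holo3 (wp i j) D"
    and base: "y0\<^sup>2 = fC a x0" "y0 \<noteq> 0"
    and defining:
      "\<And>x y x1 y1 x2 y2 x3 y3 gx gy gx1 gy1 gx2 gy2 gx3 gy3 u.
         curve_path a gx gy (x0, y0) (x, y) \<Longrightarrow>
         curve_path a gx1 gy1 (x0, y0) (x1, y1) \<Longrightarrow>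
         curve_path a gx2 gy2 (x0, y0) (x2, y2) \<Longrightarrow>
         curve_path a gx3 gy3 (x0, y0) (x3, y3) \<Longrightarrow>
         u = add3 c (add3 (abel gx gy) (add3 (abel gx1 gy1) (add3 (abel gx2 gy2) (abel gx3 gy3)))) \<Longrightarrow>
         u \<in> D \<Longrightarrow>
         y * y1 - hform (hmat a (\<lambda>i j. wp i j u)) x x1 = 0 \<and>
         y * y2 - hform (hmat a (\<lambda>i j. wp i j u)) x x2 = 0 \<and>
         y * y3 - hform (hmat a (\<lambda>i j. wp i j u)) x x3 = 0"
  shows "\<forall>u\<in>D. \<forall>i<5. \<forall>k<5.
           (\<Sum>j<5. hmat a (\<lambda>p q. wp p q u) i j *
                    Amat (\<lambda>p q r. pderiv3 (wp p q) r u) j k) = 0"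
proof -
  interpret wp_functions a wp D x0 y0 c
  proof
    show "y * y1 - hform (hmat a (\<lambda>i j. wp i j u)) x x1 = 0"
      if "curve_path a gx gy (x0, y0) (x, y)" "curve_path a gx1 gy1 (x0, y0) (x1, y1)"
        "curve_path a gx2 gy2 (x0, y0) (x2, y2)" "curve_path a gx3 gy3 (x0, y0) (x3, y3)"
        "u = add3 c (add3 (abel gx gy) (add3 (abel gx1 gy1) (add3 (abel gx2 gy2) (abel gx3 gy3))))" "u \<in> D"
      for x y x1 y1 x2 y2 x3 y3 gx gy gx1 gy1 gx2 gy2 gx3 gy3 u
      using defining [OF that] by blast
  qed (fact deg nonsing D_open holo base)+
  show ?thesis using hmat_Amat_on_domain by blast
qed

end
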